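(* Let $\Phi:\Delta\to\mathbb{R}^{n\times n}$, $\Delta=\{(t,\tau)\in\mathbb{R}\times\mathbb{R}:t\ge\tau\}$, be measurable and locally essentially bounded, and let $$f(t,x,u)=a(t,x)+b(t,x)u,\qquad \tilde f(t,x,u)=\tilde a(t,x)+\tilde b(t,x)u,\qquad t\in\mathbb{R},\ x\in\mathbb{R}^n,\ u\in\mathbb{R}^m,$$ where the measurable functions $a,\tilde a:\mathbb{R}\times\mathbb{R}^n\to\mathbb{R}^n$ and $b,\tilde b:\mathbb{R}\times\mathbb{R}^n\to\mathbb{R}^{n\times m}$ are locally essentially bounded and continuous in $x$. If a measurable function $u:\mathbb{R}\times\mathbb{R}^n\to\mathbb{R}^m$ is locally essentially bounded then, for any $t^0\in\mathbb{R}$ and any $x^0\in\mathbb{R}^n$, the IVP $$\dot x(t)=f(t,x(t),u(t,x(t)))+\int_{t^0}^t\Phi(t,\tau)\tilde f(\tau,x(\tau),u(\tau,x(\tau)))\,d\tau,\quad t>t^0,\qquad x(t^0)=x^0,$$ has an Utkin solution (of the first kind, and hence also of the second kind) defined, at least, locally in the forward time. Moreover, any Utkin solution of the first kind of this IVP is a Filippov solution of it.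
   Context: $\mathcal{B}(r)\subset\mathbb{R}^n$ is the open ball of radius $r>0$ centered at $0$. A function is locally essentially bounded on a set if its norm has finite essential supremum over every compact subset of that set. Intervals $\mathcal{I}$ are of the form $[t^0,t^0+\alpha)$ with $\alpha>0$ or $[t^0,+\infty)$. Filippov regularization of a function $g$ of $(t,x)\in\mathbb{R}\times\mathbb{R}^n$: $K[g](t,x)=\bigcap_{\delta>0}\bigcap_{\mu(M)=0}\overline{\mathrm{co}}\,g(t,x+\mathcal{B}(\delta)\setminus M)$, where $\overline{\mathrm{co}}$ is the convex closure and the intersections are over all $\delta>0$ and all $M\subset\mathbb{R}^n$ of Lebesgue measure zero. Utkin solution of the first kind (resp. second kind) of the IVP: an absolutely continuous $x:\mathcal{I}\to\mathbb{R}^n$ with $x(t^0)=x^0$ for which there is a measurable $u_{\rm eq}:\mathcal{I}\to\mathbb{R}^m$ such that, almost everywhere on $\mathcal{I}$, $u_{\rm eq}(t)\in U(t,x(t))$ and $\dot x(t)=f(t,x(t),u_{\rm eq}(t))+\int_{t^0}^t\Phi(t,\tau)\tilde f(\tau,x(\tau),u_{\rm eq}(\tau))\,d\tau$, where $U=K[u]$ (resp. $U=(K[u_1],\dots,K[u_m])^\top$, i.e. the product set, for $u=(u_1,\dots,u_m)^\top$). Filippov solution of the IVP: an absolutely continuous $x:\mathcal{I}\to\mathbb{R}^n$ with $x(t^0)=x^0$ such that for almost all $t\in\mathcal{I}$, $\dot x(t)\in K[F](t,x(t))+\int_{t^0}^t\Phi(t,\tau)K[\tilde F](\tau,x(\tau))\,d\tau$,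 where $F(t,x)=f(t,x,u(t,x))$, $\tilde F(t,x)=\tilde f(t,x,u(t,x))$ and the integral of the set-valued map is in the sense of Aumann. *)

theory Defs
  imports "HOL-Analysis.Analysis" "HOL-Probability.Essential_Supremum"
begin

definition locally_essentially_bounded_on ::
  "'a::euclidean_space set \<Rightarrow> ('a \<Rightarrow> 'b::real_normed_vector) \<Rightarrow> bool" where
  "locally_essentially_bounded_on S g \<longleftrightarrow>
     (\<forall>C. compact C \<and> C \<subseteq> S \<longrightarrow> esssup (lebesgue_on C) (\<lambda>z. ereal (norm (g z))) < \<infinity>)"

text \<open>The \<open>\<epsilon>\<close>-\<open>\<delta>\<close> definition; \<open>D\<close> is an arbitrary finite family of non-overlapping compact
  intervals contained in \<open>S\<close>.\<close>

definition absolutely_continuous_on ::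
  "real set \<Rightarrow> (real \<Rightarrow> 'a::real_normed_vector) \<Rightarrow> bool" where
  "absolutely_continuous_on S x \<longleftrightarrow>
     (\<forall>\<epsilon>>0. \<exists>\<delta>>0. \<forall>D. D division_of \<Union>D \<and> \<Union>D \<subseteq> S \<and> (\<Sum>k\<in>D. measure lborel k) < \<delta>
        \<longrightarrow> (\<Sum>k\<in>D. norm (x (Sup k) - x (Inf k))) < \<epsilon>)"

definition forward_interval :: "real \<Rightarrow> real set \<Rightarrow> bool" where
  "forward_interval t0 I \<longleftrightarrow> (\<exists>\<alpha>>0. I = {t0..<t0 + \<alpha>}) \<or> I = {t0..}"

definition filippov_reg ::
  "(real \<times> 'a::euclidean_space \<Rightarrow> 'b::real_normed_vector) \<Rightarrow> real \<Rightarrow> 'a \<Rightarrow> 'b set" where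
  "filippov_reg g t x =
     (\<Inter>\<delta>\<in>{0<..}. \<Inter>M\<in>null_sets lebesgue.
        closure (convex hull ((\<lambda>y. g (t, y)) ` (ball x \<delta> - M))))"

text \<open>Selections are required to lie in the set-valued map almost everywhere.\<close>

definition aumann_integral ::
  "'a measure \<Rightarrow> ('a \<Rightarrow> 'b::{banach, second_countable_topology} set) \<Rightarrow> 'b set" where
  "aumann_integral M G = {integral\<^sup>L M g | g. integrable M g \<and> (AE s in M. g s \<in> G s)}"

text \<open>The trajectory is absolutely continuous on a non-compact interval in the usual sense of
  differential equations, i.e. on each of its compact subintervals; otherwise trajectories on
  \<open>{t0..}\<close> such as the exponential function would be excluded.\<close>

definition ac_trajectory ::
  "real \<Rightarrow> 'a::real_normed_vector \<Rightarrow> real set \<Rightarrow> (real \<Rightarrow> 'a) \<Rightarrow> bool" where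
  "ac_trajectory t0 x0 I x \<longleftrightarrow>
     forward_interval t0 I \<and> x t0 = x0 \<and>
     (\<forall>s1 s2. {s1..s2} \<subseteq> I \<longrightarrow> absolutely_continuous_on {s1..s2} x)"

text \<open>The set-valued map \<open>U\<close> is the only difference between the two kinds of Utkin solution.
  The predicate \<open>has_bochner_integral\<close> states both that the Lebesgue integral
  exists and that its value is \<open>w\<close>.\<close>

definition utkin_solution ::
  "(real \<Rightarrow> real^'n \<Rightarrow> (real^'m) set) \<Rightarrow> (real \<times> real \<Rightarrow> real^'n^'n) \<Rightarrow>
   (real \<Rightarrow> real^'n \<Rightarrow> real^'m \<Rightarrow> real^'n) \<Rightarrow> (real \<Rightarrow> real^'n \<Rightarrow> real^'m \<Rightarrow> real^'n) \<Rightarrow>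
   real \<Rightarrow> real^'n \<Rightarrow> real set \<Rightarrow> (real \<Rightarrow> real^'n) \<Rightarrow> bool" where
  "utkin_solution U \<Phi> f f' t0 x0 I x \<longleftrightarrow>
     ac_trajectory t0 x0 I x \<and>
     (\<exists>ueq \<in> borel_measurable (lebesgue_on I).
        AE t in lebesgue_on I.
          ueq t \<in> U t (x t) \<and>
          (\<exists>w. has_bochner_integral (lebesgue_on {t0..t})
                 (\<lambda>\<tau>. \<Phi> (t, \<tau>) *v f' \<tau> (x \<tau>) (ueq \<tau>)) w \<and>
               (x has_vector_derivative f t (x t) (ueq t) + w) (at t within I)))"

definition utkin_solution_first ::
  "(real \<times> (real^'n) \<Rightarrow> real^'m) \<Rightarrow> (real \<times> real \<Rightarrow> real^'n^'n) \<Rightarrow>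
   (real \<Rightarrow> real^'n \<Rightarrow> real^'m \<Rightarrow> real^'n) \<Rightarrow> (real \<Rightarrow> real^'n \<Rightarrow> real^'m \<Rightarrow> real^'n) \<Rightarrow>
   real \<Rightarrow> real^'n \<Rightarrow> real set \<Rightarrow> (real \<Rightarrow> real^'n) \<Rightarrow> bool" where
  "utkin_solution_first u = utkin_solution (filippov_reg u)"

definition utkin_solution_second ::
  "(real \<times> (real^'n) \<Rightarrow> real^'m) \<Rightarrow> (real \<times> real \<Rightarrow> real^'n^'n) \<Rightarrow>
   (real \<Rightarrow> real^'n \<Rightarrow> real^'m \<Rightarrow> real^'n) \<Rightarrow> (real \<Rightarrow> real^'n \<Rightarrow> real^'m \<Rightarrow> real^'n) \<Rightarrow>
   real \<Rightarrow> real^'n \<Rightarrow> real set \<Rightarrow> (real \<Rightarrow> real^'n) \<Rightarrow> bool" where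
  "utkin_solution_second u =
     utkin_solution (\<lambda>t x. {v. \<forall>i. v $ i \<in> filippov_reg (\<lambda>p. u p $ i) t x})"

text \<open>The sum below is the Minkowski sum of sets.\<close>

definition filippov_solution ::
  "(real \<times> (real^'n) \<Rightarrow> real^'m) \<Rightarrow> (real \<times> real \<Rightarrow> real^'n^'n) \<Rightarrow>
   (real \<Rightarrow> real^'n \<Rightarrow> real^'m \<Rightarrow> real^'n) \<Rightarrow> (real \<Rightarrow> real^'n \<Rightarrow> real^'m \<Rightarrow> real^'n) \<Rightarrow>
   real \<Rightarrow> real^'n \<Rightarrow> real set \<Rightarrow> (real \<Rightarrow> real^'n) \<Rightarrow> bool" where
  "filippov_solution u \<Phi> f f' t0 x0 I x \<longleftrightarrow>
     ac_trajectory t0 x0 I x \<and>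
     (AE t in lebesgue_on I.
        \<exists>v. (x has_vector_derivative v) (at t within I) \<and>
            v \<in> filippov_reg (\<lambda>(s, y). f s y (u (s, y))) t (x t) +
                aumann_integral (lebesgue_on {t0..t})
                  (\<lambda>\<tau>. (\<lambda>y. \<Phi> (t, \<tau>) *v y) `
                        filippov_reg (\<lambda>(s, y). f' s y (u (s, y))) \<tau> (x \<tau>)))"

end

theory Submission
  imports Defs "HOL-Complex_Analysis.Great_Picard"
begin

text \<open>The second claim is local in time. For almost every \<open>t\<close> the section \<open>u (t, \<cdot>)\<close> is locally
  essentially bounded, and then the continuity of \<open>a\<close> and \<open>b\<close> in the state gives
  \<open>a + b K[u] \<subseteq> K[a + b u]\<close> (lemma \<open>filippov_reg_affine\<close>). Applied to \<open>f\<close> this handles the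
  first summand of the velocity; applied to \<open>f'\<close> it says that
  \<open>\<tau> \<mapsto> \<Phi> (t, \<tau>) f' (\<tau>, x \<tau>, u\<^sub>e\<^sub>q \<tau>)\<close> is a selection of the integrand of the Aumann integral. An
  Utkin solution of the first kind is one of the second kind because the \<open>i\<close>-th projection of
  \<open>K[u]\<close> lies in \<open>K[u\<^sub>i]\<close> (lemma \<open>filippov_reg_component\<close>).

  Existence is a compactness argument on explicitly solvable approximations. On a compact
  neighbourhood of the initial point the coefficients, the feedback \<open>u\<close> and the kernel are replaced
  by bounded Borel functions that agree with them almost everywhere; those that depend on the state
  are then averaged in it over balls of radius \<open>1/(k+1)\<close>. Averaging serves two purposes: it makes the values insensitive to
  null sets, so that a trajectory may run inside a null set of states, and an average of
  \<open>u (t, \<cdot>)\<close> over a small ball lies in the closed convex hull of the essential values of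
  \<open>u (t, \<cdot>)\<close> on that ball. The averaged equation, with the state on the right-hand side delayed by
  \<open>1/(k+1)\<close>, is solved explicitly, step by step
  (lemma \<open>delayed_integral_equation_solution\<close>). The solutions are equi-Lipschitz, so by the
  Arzela-Ascoli theorem a subsequence converges uniformly to some \<open>x\<close>.

  The controls \<open>v j t\<close> met along the approximations are only bounded. Instead of extracting a weak
  limit, one takes convex combinations of the tails \<open>v k, v (k+1), \<dots>\<close> of almost minimal \<open>L\<^sup>2\<close> norm;
  the parallelogram law makes them Cauchy, and a subsequence converges almost everywhere
  (lemma \<open>convex_tails_AE_convergent\<close>). Its limit is the equivalent control \<open>u\<^sub>e\<^sub>q\<close>. Since \<open>f\<close> and
  \<open>f'\<close> are affine in the control and their coefficients converge along the approximations, the same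
  convex combinations of the right-hand sides converge to the right-hand side for \<open>u\<^sub>e\<^sub>q\<close>, and those
  of the trajectories still converge to \<open>x\<close>; dominated convergence yields the integral equation
  (lemma \<open>volterra_equation_limit\<close>). As \<open>u\<^sub>e\<^sub>q t\<close> is a limit of convex combinations of averages of
  \<open>u (t, \<cdot>)\<close> over balls that shrink to \<open>x t\<close>, it belongs to \<open>K[u] (t, x t)\<close>.

  It remains to differentiate the integral equation almost everywhere. That is Lebesgue's
  differentiation theorem on the line, which follows here from Henstock's lemma and Vitali's
  covering theorem (lemma \<open>indefinite_integral_has_vector_derivative_ae\<close>).\<close>

section \<open>Differentiability of indefinite integrals almost everywhere\<close>

text \<open>Vitali's theorem covers the bad points, up to a null set, by disjoint small balls. One half of each
  ball is a bad interval tagged at the centre, so any finitely many of them form a partial division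
  to which Henstock's lemma applies: it bounds the sum of the deviations, hence \<open>e\<close> times the sum of
  the lengths, by an arbitrarily small number.\<close>

lemma indefinite_integral_bad_set_negligible:
  fixes f :: "real \<Rightarrow> 'a::euclidean_space"
  assumes f: "f integrable_on {a..b}" and e: "0 < e"
  defines "bad \<equiv> \<lambda>t J. e * measure lborel J \<le> norm (measure lborel J *\<^sub>R f t - integral J f)"
  shows "negligible {t. \<forall>d>0. \<exists>h. 0 < h \<and> h < d \<and> {t-h..t+h} \<subseteq> {a..b} \<and>
            (bad t {t..t+h} \<or> bad t {t-h..t})}" (is "negligible ?E")
  unfolding negligible_outer_le
proof (intro allI impI)
  fix \<epsilon> :: real assume "0 < \<epsilon>"
  \<comment> \<open>The bad interval is half of its ball, whence the factor \<open>1/2\<close> in the bound.\<close>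
  obtain \<gamma> where \<gamma>: "gauge \<gamma>"
    and hen: "\<And>p. \<lbrakk>p tagged_partial_division_of (cbox a b); \<gamma> fine p\<rbrakk> \<Longrightarrow>
             sum (\<lambda>(x,k). norm(measure lborel k *\<^sub>R f x - integral k f)) p < \<epsilon> * e / 2"
    using Henstock_lemma[of f a b "\<epsilon> * e / 2"] f e \<open>0 < \<epsilon>\<close> by auto
  \<comment> \<open>The choice of the bad half is part of the index, so that each ball comes with one interval.\<close>
  define K where "K = {(t, h, J). 0 < h \<and> {t-h..t+h} \<subseteq> {a..b} \<and> {t-h..t+h} \<subseteq> \<gamma> t \<and>
      (J = {t..t+h} \<or> J = {t-h..t}) \<and> bad t J}"
  have cov: "\<exists>i. i \<in> K \<and> t \<in> ball (fst i) (fst (snd i)) \<and> fst (snd i) < d" if t: "t \<in> ?E" "0 < d" for t d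
  proof -
    obtain r where r: "0 < r" "ball t r \<subseteq> \<gamma> t"
      using \<gamma> unfolding gauge_def by (meson openE)
    have "0 < min d r" using that r by simp
    then obtain h where h: "0 < h" "h < min d r" "{t-h..t+h} \<subseteq> {a..b}" "bad t {t..t+h} \<or> bad t {t-h..t}"
      using t(1) by blast
    have "{t-h..t+h} \<subseteq> \<gamma> t"
      using h(2) r(2) by (force simp: subset_iff dist_real_def)
    then have "(t, h, {t..t+h}) \<in> K \<or> (t, h, {t-h..t}) \<in> K"
      using h by (auto simp: K_def)
    moreover have "t \<in> ball t h" "h < d" using h by auto
    ultimately show ?thesis by (metis fst_conv snd_conv)
  qed
  obtain C where C: "countable C" "C \<subseteq> K"
     "pairwise (\<lambda>i j. disjnt (ball (fst i) (fst (snd i))) (ball (fst j) (fst (snd j)))) C"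
     "negligible (?E - (\<Union>i \<in> C. ball (fst i) (fst (snd i))))"
    using Vitali_covering_theorem_balls[of ?E K fst "\<lambda>i. fst (snd i)"] cov by blast
  let ?B = "\<lambda>i::real \<times> real \<times> real set. ball (fst i) (fst (snd i))"
  have fin: "measure lebesgue (\<Union>i\<in>D. ?B i) \<le> \<epsilon>" if D: "D \<subseteq> C" "finite D" for D
  proof -
    define p where "p = (\<lambda>(t, h, J). (t, J)) ` D"
    have DD: "0 < h \<and> {t-h..t+h} \<subseteq> {a..b} \<and> {t-h..t+h} \<subseteq> \<gamma> t \<and>
      (J = {t..t+h} \<or> J = {t-h..t}) \<and> bad t J" if "(t, h, J) \<in> D" for t h J
      using that D C(2) by (auto simp: K_def)
    have disj: "ball t h \<inter> ball t' h' = {}" if "(t, h, J) \<in> D" "(t', h', J') \<in> D" "(t, h, J) \<noteq> (t', h', J')"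
      for t h J t' h' J'
    proof -
      have "disjnt (?B (t, h, J)) (?B (t', h', J'))"
        using pairwiseD[OF C(3) _ _ that(3)] D(1) that(1,2) by (meson subsetD)
      then show ?thesis by (simp add: disjnt_def)
    qed
    have inj: "inj_on (\<lambda>(t, h, J). (t, J)) D"
    proof (rule inj_onI, clarsimp)
      fix t h J h' assume 1: "(t, h, J) \<in> D" "(t, h', J) \<in> D"
      have "t \<in> ball t h \<inter> ball t h'" using DD[OF 1(1)] DD[OF 1(2)] by auto
      then show "h = h'" using disj[OF 1] by blast
    qed
    have tp: "p tagged_partial_division_of cbox a b"
      unfolding tagged_partial_division_of_def
    proof (intro conjI allI impI)
      show "finite p" using D by (simp add: p_def)
    next
      fix x k assume "(x, k) \<in> p"
      then obtain h where h: "(x, h, k) \<in> D" by (auto simp: p_def)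
      show "x \<in> k" "k \<subseteq> cbox a b" using DD[OF h] by auto
      show "\<exists>a b. k = cbox a b" using DD[OF h] by auto
    next
      fix x1 k1 x2 k2 assume *: "(x1, k1) \<in> p \<and> (x2, k2) \<in> p \<and> (x1, k1) \<noteq> (x2, k2)"
      then obtain h1 h2 where h: "(x1, h1, k1) \<in> D" "(x2, h2, k2) \<in> D" by (auto simp: p_def)
      have "interior k1 \<subseteq> ball x1 h1" "interior k2 \<subseteq> ball x2 h2"
        using DD[OF h(1)] DD[OF h(2)] by (auto simp: dist_real_def)
      then show "interior k1 \<inter> interior k2 = {}"
        using disj[OF h] * by blast
    qed
    have fine: "\<gamma> fine p"
      unfolding fine_def
    proof (clarsimp)
      fix x k s assume "(x, k) \<in> p" "s \<in> k"
      then obtain h where h: "(x, h, k) \<in> D" by (auto simp: p_def)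
      have "k \<subseteq> {x-h..x+h}" using DD[OF h] by auto
      then show "s \<in> \<gamma> x" using DD[OF h] \<open>s \<in> k\<close> by blast
    qed
    have "e * measure lebesgue (\<Union>i\<in>D. ?B i) \<le> e * (\<Sum>i\<in>D. measure lebesgue (?B i))"
      using e D by (intro mult_left_mono measure_UNION_le) auto
    also have "\<dots> = (\<Sum>i\<in>D. e * measure lebesgue (?B i))"
      by (simp add: sum_distrib_left)
    also have "\<dots> \<le> (\<Sum>i\<in>D. 2 * (case i of (t, h, J) \<Rightarrow> norm (measure lborel J *\<^sub>R f t - integral J f)))"
    proof (intro sum_mono)
      fix i assume "i \<in> D"
      obtain t h J where i: "i = (t, h, J)" by (cases i) auto
      have *: "0 < h" "J = {t..t+h} \<or> J = {t-h..t}" "bad t J" using DD \<open>i \<in> D\<close> i by auto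
      have "measure lebesgue (?B i) = 2 * measure lborel J"
        using * by (auto simp: i ball_eq_greaterThanLessThan)
      then show "e * measure lebesgue (?B i) \<le> 2 * (case i of (t, h, J) \<Rightarrow> norm (measure lborel J *\<^sub>R f t - integral J f))"
        using *(3) by (simp add: i bad_def)
    qed
    also have "\<dots> = 2 * (\<Sum>(t,J)\<in>p. norm (measure lborel J *\<^sub>R f t - integral J f))"
      unfolding p_def by (subst sum.reindex[OF inj]) (simp add: sum_distrib_left case_prod_beta)
    also have "\<dots> \<le> \<epsilon> * e" using hen[OF tp fine] by simp
    finally show ?thesis using e by (simp add: mult.commute)
  qed
  define U where "U = (\<Union>i\<in>C. ?B i)"
  have U: "U \<in> lmeasurable \<and> measure lebesgue U \<le> \<epsilon>"
  proof (cases "C = {}")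
    case True then show ?thesis using \<open>0 < \<epsilon>\<close> by (simp add: U_def)
  next
    case False
    let ?S = "\<lambda>n. ?B (from_nat_into C n)"
    have "U = (\<Union>n. ?S n)"
      unfolding U_def by (subst range_from_nat_into[OF False C(1), symmetric]) (simp only: image_image)
    moreover have "measure lebesgue (\<Union>i\<le>n. ?S i) \<le> \<epsilon>" for n
    proof -
      have "(\<Union>i\<le>n. ?S i) = (\<Union>i\<in>from_nat_into C ` {..n}. ?B i)" by auto
      then show ?thesis
        using fin[of "from_nat_into C ` {..n}"] from_nat_into[OF False] by (simp add: image_subset_iff)
    qed
    ultimately show ?thesis
      using fmeasurable_countable_Union[of ?S lebesgue \<epsilon>] measure_countable_Union_le[of ?S lebesgue \<epsilon>] by auto
  qed
  have N: "?E - U \<in> null_sets lebesgue"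
    using C(4) by (simp add: U_def negligible_iff_null_sets)
  show "\<exists>T. ?E \<subseteq> T \<and> T \<in> lmeasurable \<and> measure lebesgue T \<le> \<epsilon>"
  proof (intro exI conjI)
    show "?E \<subseteq> U \<union> (?E - U)" by blast
    show "U \<union> (?E - U) \<in> lmeasurable"
      by (rule fmeasurable.Un[OF conjunct1[OF U] fmeasurableI_null_sets[OF N]])
    have "measure lebesgue (U \<union> (?E - U)) = measure lebesgue U"
      using measure_Un_null_set[OF _ N, of U] U by (blast intro: fmeasurableD)
    then show "measure lebesgue (U \<union> (?E - U)) \<le> \<epsilon>" using U by simp
  qed
qed

lemma indefinite_integral_has_vector_derivative_ae:
  fixes f :: "real \<Rightarrow> 'a::euclidean_space"
  assumes f: "f integrable_on {a..b}"
  shows "AE t in lborel. t \<in> {a<..<b} \<longrightarrow>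
           ((\<lambda>s. integral {a..s} f) has_vector_derivative f t) (at t)"
proof -
  define bad where "bad e t J \<longleftrightarrow> e * measure lborel J \<le> norm (measure lborel J *\<^sub>R f t - integral J f)" for e :: real and t J
  define E where "E e = {t. \<forall>d>0. \<exists>h. 0 < h \<and> h < d \<and> {t-h..t+h} \<subseteq> {a..b} \<and>
            (bad e t {t..t+h} \<or> bad e t {t-h..t})}" for e
  have "E (inverse (real (Suc n))) \<in> null_sets lebesgue" for n
    using indefinite_integral_bad_set_negligible[OF f, of "inverse (real (Suc n))"]
    by (simp add: E_def bad_def negligible_iff_null_sets)
  then have "AE t in lebesgue. \<forall>n. t \<notin> E (inverse (real (Suc n)))"
    using AE_not_in by (auto simp: AE_all_countable)
  then have "AE t in lborel. \<forall>n. t \<notin> E (inverse (real (Suc n)))"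
    by (simp add: AE_completion_iff)
  then show ?thesis
  proof (rule AE_mp, intro AE_I2 impI)
    fix t assume nE: "\<forall>n. t \<notin> E (inverse (real (Suc n)))" and t: "t \<in> {a<..<b}"
    let ?F = "\<lambda>s. integral {a..s} f"
    show "(?F has_vector_derivative f t) (at t)"
      unfolding has_vector_derivative_def has_derivative_at_alt
    proof (intro conjI allI impI)
      show "bounded_linear (\<lambda>x. x *\<^sub>R f t)" by (rule bounded_linear_scaleR_left)
      fix e :: real assume "0 < e"
      then obtain n where n: "inverse (real (Suc n)) < e" using reals_Archimedean by blast
      let ?e = "inverse (real (Suc n))"
      have "\<not> (\<forall>d>0. \<exists>h. 0 < h \<and> h < d \<and> {t-h..t+h} \<subseteq> {a..b} \<and>
            (bad ?e t {t..t+h} \<or> bad ?e t {t-h..t}))"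
        using nE[THEN spec, of n] unfolding E_def mem_Collect_eq .
      then obtain d where d: "0 < d" "\<And>h. 0 < h \<Longrightarrow> h < d \<Longrightarrow> {t-h..t+h} \<subseteq> {a..b} \<Longrightarrow>
            \<not> bad ?e t {t..t+h} \<and> \<not> bad ?e t {t-h..t}"
        by blast
      define d' where "d' = min d (min (t - a) (b - t))"
      have "norm (?F y - ?F t - (y - t) *\<^sub>R f t) \<le> e * norm (y - t)" if y: "norm (y - t) < d'" for y
      proof -
        define h where "h = \<bar>y - t\<bar>"
        consider "y = t" | "y > t" | "y < t" by linarith
        then show ?thesis
        proof cases
          case 2
          have h: "0 < h" "h < d" "{t-h..t+h} \<subseteq> {a..b}" "y = t + h" using 2 y t by (auto simp: h_def d'_def)
          have "?F y = ?F t + integral {t..y} f"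
            using h t integrable_subinterval_real[OF f, of a y]
            by (intro Henstock_Kurzweil_Integration.integral_combine[symmetric]) auto
          moreover have "norm (h *\<^sub>R f t - integral {t..t+h} f) \<le> ?e * h"
            using d(2)[OF h(1-3)] h(1) by (simp add: bad_def)
          ultimately have "norm (?F y - ?F t - (y - t) *\<^sub>R f t) \<le> ?e * h"
            using h by (simp add: norm_minus_commute)
          also have "\<dots> \<le> e * h" using n h by simp
          finally show ?thesis by (simp add: h_def)
        next
          case 3
          have h: "0 < h" "h < d" "{t-h..t+h} \<subseteq> {a..b}" "y = t - h" using 3 y t by (auto simp: h_def d'_def)
          have "?F t = ?F y + integral {y..t} f"
            using h t integrable_subinterval_real[OF f, of a t]
            by (intro Henstock_Kurzweil_Integration.integral_combine[symmetric]) auto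
          moreover have "norm (h *\<^sub>R f t - integral {t-h..t} f) \<le> ?e * h"
            using d(2)[OF h(1-3)] h(1) by (simp add: bad_def)
          ultimately have "norm (?F y - ?F t - (y - t) *\<^sub>R f t) \<le> ?e * h"
            using h by (simp add: norm_minus_commute)
          also have "\<dots> \<le> e * h" using n h by simp
          finally show ?thesis by (simp add: h_def)
        qed auto
      qed
      moreover have "0 < d'" using d t by (simp add: d'_def)
      ultimately show "\<exists>d>0. \<forall>y. norm (y - t) < d \<longrightarrow> norm (?F y - ?F t - (y - t) *\<^sub>R f t) \<le> e * norm (y - t)"
        by blast
    qed
  qed
qed

section \<open>Bounded Borel representatives and sections\<close>

lemma lebesgue_measurable_borel_representative:
  fixes h :: "'a::euclidean_space \<Rightarrow> 'b::euclidean_space"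
  assumes "h \<in> borel_measurable lebesgue"
  obtains k where "k \<in> borel_measurable borel" "AE z in lborel. h z = k z"
proof -
  have "\<exists>k. k \<in> borel_measurable lborel \<and> (AE z in lborel. h z \<bullet> i = k z)" for i
    using completion_ex_borel_measurable_real[of "\<lambda>z. h z \<bullet> i" lborel] assms by auto
  then obtain k where k: "\<And>i. k i \<in> borel_measurable lborel" "\<And>i. AE z in lborel. h z \<bullet> i = k i z"
    by metis
  show thesis
  proof
    show "(\<lambda>z. \<Sum>i\<in>Basis. k i z *\<^sub>R i) \<in> borel_measurable borel"
      using k(1) by measurable
    have "AE z in lborel. \<forall>i\<in>Basis. h z \<bullet> i = k i z"
      using k(2) by (intro AE_finite_allI) auto
    then show "AE z in lborel. h z = (\<Sum>i\<in>Basis. k i z *\<^sub>R i)"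
    proof (rule AE_mp, intro AE_I2 impI)
      fix z assume "\<forall>i\<in>Basis. h z \<bullet> i = k i z"
      then have "(\<Sum>i\<in>Basis. k i z *\<^sub>R i) = (\<Sum>i\<in>Basis. (h z \<bullet> i) *\<^sub>R i)" by simp
      then show "h z = (\<Sum>i\<in>Basis. k i z *\<^sub>R i)" by (simp add: euclidean_representation)
    qed
  qed
qed

text \<open>The constant is real although the essential supremum may be \<open>-\<infinity>\<close>, its value on null sets.\<close>

lemma locally_essentially_bounded_onD:
  fixes g :: "'a::euclidean_space \<Rightarrow> 'b::real_normed_vector"
  assumes "locally_essentially_bounded_on S g" "compact C" "C \<subseteq> S"
  obtains R where "0 \<le> R" "AE z in lborel. z \<in> C \<longrightarrow> norm (g z) \<le> R"
proof -
  let ?e = "esssup (lebesgue_on C) (\<lambda>z. ereal (norm (g z)))"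
  have "?e < \<infinity>" using assms by (simp add: locally_essentially_bounded_on_def)
  then obtain R where R: "0 \<le> R" "?e \<le> ereal R"
    by (cases ?e) (auto intro: that[of "max 0 _"], meson ereal_less_eq(3) max.cobounded1 max.cobounded2)
  have C: "C \<in> sets lebesgue" using assms(2) by (simp add: compact_imp_closed)
  have "AE z in lebesgue_on C. ereal (norm (g z)) \<le> ?e" by (rule esssup_AE)
  then have "AE z in lebesgue_on C. norm (g z) \<le> R"
    by eventually_elim (metis R(2) ereal_less_eq(3) order_trans)
  then have "AE z in lebesgue. z \<in> C \<longrightarrow> norm (g z) \<le> R"
    using C by (subst (asm) AE_restrict_space_iff) auto
  then show thesis using R(1) that by (simp add: AE_completion_iff)
qed

text \<open>Borel measurability survives restriction to sections and composition with continuous curves, which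
  Lebesgue measurability does not. A representative with a bound valid everywhere makes all
  integrals below converge for every trajectory.\<close>

lemma bounded_borel_representative:
  fixes g :: "'a::euclidean_space \<Rightarrow> 'b::euclidean_space"
  assumes S: "g \<in> borel_measurable (lebesgue_on S)" "locally_essentially_bounded_on S g"
    and C: "compact C" "C \<subseteq> S"
  obtains g0 R where "g0 \<in> borel_measurable borel" "0 \<le> R" "\<And>z. norm (g0 z) \<le> R"
    "\<And>z. z \<notin> C \<Longrightarrow> g0 z = 0" "AE z in lborel. z \<in> C \<longrightarrow> g0 z = g z"
proof -
  have Cs: "C \<in> sets lebesgue" "C \<in> sets borel" using C(1) by (simp_all add: compact_imp_closed)
  have "g \<in> borel_measurable (lebesgue_on C)"
    using S(1) C(2) by (rule measurable_restrict_mono)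
  then have "(\<lambda>z. if z \<in> C then g z else 0) \<in> borel_measurable lebesgue"
    using Cs by (simp add: borel_measurable_if)
  then obtain k where k[measurable]: "k \<in> borel_measurable borel"
    and kg: "AE z in lborel. (if z \<in> C then g z else 0) = k z"
    using lebesgue_measurable_borel_representative by blast
  obtain R where R: "0 \<le> R" "AE z in lborel. z \<in> C \<longrightarrow> norm (g z) \<le> R"
    using locally_essentially_bounded_onD[OF S(2) C] .
  show thesis
  proof (rule that[of "\<lambda>z. if z \<in> C \<and> norm (k z) \<le> R then k z else 0" R])
    show "(\<lambda>z. if z \<in> C \<and> norm (k z) \<le> R then k z else 0) \<in> borel_measurable borel"
      using Cs(2) by measurable
    show "AE z in lborel. z \<in> C \<longrightarrow> (if z \<in> C \<and> norm (k z) \<le> R then k z else 0) = g z"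
      using kg R(2) by eventually_elim auto
  qed (use R(1) in auto)
qed

corollary compact_borel_representative:
  fixes g :: "'a::euclidean_space \<Rightarrow> 'b::euclidean_space"
  assumes "g \<in> borel_measurable lebesgue" "locally_essentially_bounded_on UNIV g" "compact C"
  obtains g0 R where "g0 \<in> borel_measurable borel" "0 \<le> R" "\<And>z. norm (g0 z) \<le> R"
    "AE z in lborel. z \<in> C \<longrightarrow> g0 z = g z"
proof -
  have "g \<in> borel_measurable (lebesgue_on UNIV)" using assms(1) by (simp add: lebesgue_on_UNIV_eq)
  from bounded_borel_representative[OF this assms(2,3) subset_UNIV] that show thesis by metis
qed

lemma AE_lborel_slices:
  assumes "AE z in (lborel :: ('a::euclidean_space \<times> 'b::euclidean_space) measure). P z"
  shows "AE t in lborel. AE y in lborel. P (t, y)"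
proof -
  have "AE z in (lborel :: 'a measure) \<Otimes>\<^sub>M (lborel :: 'b measure). P z"
    using assms by (simp only: lborel_prod)
  then show ?thesis by (rule lborel_pair.AE_pair)
qed

lemma bounded_set_integrable_lborel:
  fixes g :: "'a::euclidean_space \<Rightarrow> 'b::euclidean_space"
  assumes "g \<in> borel_measurable borel" "\<And>y. norm (g y) \<le> R" "S \<in> sets borel" "emeasure lborel S < \<infinity>"
  shows "set_integrable lborel S g"
  unfolding set_integrable_def
proof (rule integrableI_bounded_set[where A=S and B=R])
  show "S \<in> sets lborel" using assms(3) by simp
  show "(\<lambda>x. indicat_real S x *\<^sub>R g x) \<in> borel_measurable lborel"
    using assms(1,3) by measurable
qed (use assms order_trans[OF norm_ge_zero assms(2)] in \<open>auto intro!: AE_I2 simp: indicator_def\<close>)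

section \<open>Averages over balls\<close>

definition ball_average :: "('a::euclidean_space \<Rightarrow> 'b::euclidean_space) \<Rightarrow> real \<Rightarrow> 'a \<Rightarrow> 'b" where
  "ball_average g r x = (LINT y:ball x r|lborel. g y) /\<^sub>R measure lborel (ball x r)"

text \<open>Otherwise a hyperplane would separate the average strictly from the closed convex set, and
  integrating the strict inequality over the ball would contradict it. With closed balls for \<open>S\<close> this gives
  bounds and limits of averages; with the hulls that define the Filippov regularization it gives
  membership in that regularization.\<close>

lemma ball_average_in_closed_convex:
  fixes g :: "'a::euclidean_space \<Rightarrow> 'b::euclidean_space"
  assumes g: "g \<in> borel_measurable borel" "\<And>y. norm (g y) \<le> R" and "0 < r"
    and S: "convex S" "closed S" and ae: "AE y in lborel. y \<in> ball x r \<longrightarrow> g y \<in> S"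
  shows "ball_average g r x \<in> S"
proof (rule ccontr)
  assume "ball_average g r x \<notin> S"
  then obtain c b where c: "c \<bullet> ball_average g r x < b" "\<And>s. s \<in> S \<Longrightarrow> c \<bullet> s > b"
    using separating_hyperplane_closed_point[OF S] by blast
  let ?m = "measure lborel (ball x r)"
  have m: "0 < ?m" using \<open>0 < r\<close> by (rule content_ball_pos)
  have fin: "emeasure lborel (ball x r) < \<infinity>" using emeasure_lborel_ball_finite by blast
  have int: "integrable lborel (\<lambda>y. indicat_real (ball x r) y *\<^sub>R g y)"
    using bounded_set_integrable_lborel[OF g _ fin] by (simp add: set_integrable_def)
  have int1: "integrable lborel (\<lambda>y. indicat_real (ball x r) y * b)"
    using fin by (intro integrable_mult_left) (simp add: integrable_real_indicator)
  have "?m * b = (\<integral>y. indicat_real (ball x r) y * b \<partial>lborel)" by simp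
  also have "\<dots> \<le> (\<integral>y. c \<bullet> (indicat_real (ball x r) y *\<^sub>R g y) \<partial>lborel)"
  proof (rule integral_mono_AE[OF int1])
    show "integrable lborel (\<lambda>y. c \<bullet> (indicat_real (ball x r) y *\<^sub>R g y))"
      using int by (rule integrable_inner_right)
    show "AE y in lborel. indicat_real (ball x r) y * b \<le> c \<bullet> (indicat_real (ball x r) y *\<^sub>R g y)"
      using ae by eventually_elim (auto simp: indicator_def less_imp_le c(2))
  qed
  also have "\<dots> = c \<bullet> (LINT y:ball x r|lborel. g y)"
    unfolding set_lebesgue_integral_def by (rule integral_inner_right) (rule int)
  also have "\<dots> = ?m * (c \<bullet> ball_average g r x)"
    using m by (simp add: ball_average_def)
  also have "\<dots> < ?m * b" using c(1) m by simp
  finally show False by simp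
qed

lemma borel_measurable_ball_average:
  fixes g :: "real \<times> 'a::euclidean_space \<Rightarrow> 'b::euclidean_space"
  assumes g[measurable]: "g \<in> borel_measurable borel" and "0 < r"
  shows "(\<lambda>z. ball_average (\<lambda>y. g (fst z, y)) r (snd z)) \<in> borel_measurable borel"
proof -
  have "(\<lambda>(z, y). if dist (snd z) y < r then g (fst z, y) else 0)
          \<in> borel_measurable ((borel :: (real \<times> 'a) measure) \<Otimes>\<^sub>M (lborel :: 'a measure))"
  proof -
    have sets: "sets ((borel :: (real \<times> 'a) measure) \<Otimes>\<^sub>M (lborel :: 'a measure)) = sets borel"
      by (simp add: borel_prod[symmetric] cong: sets_pair_measure_cong)
    have "(\<lambda>w. (fst (fst w), snd w)) \<in> borel_measurable (borel :: ((real \<times> 'a) \<times> 'a) measure)"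
      by (intro borel_measurable_continuous_onI continuous_intros)
    then have "(\<lambda>w. g (fst (fst w), snd w)) \<in> borel_measurable (borel :: ((real \<times> 'a) \<times> 'a) measure)"
      by measurable
    moreover have "open {w :: (real \<times> 'a) \<times> 'a. dist (snd (fst w)) (snd w) < r}"
      by (intro open_Collect_less continuous_intros)
    ultimately have "(\<lambda>w. if dist (snd (fst w)) (snd w) < r then g (fst (fst w), snd w) else 0)
        \<in> borel_measurable (borel :: ((real \<times> 'a) \<times> 'a) measure)"
      by (intro measurable_If) auto
    then show ?thesis
      by (simp add: measurable_cong_sets[OF sets refl] case_prod_beta)
  qed
  then have "(\<lambda>z. \<integral>y. (if dist (snd z) y < r then g (fst z, y) else 0) \<partial>lborel) \<in> borel_measurable (borel :: (real \<times> 'a) measure)"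
    by (rule lborel.borel_measurable_lebesgue_integral)
  moreover have "(if dist x y < r then g (t, y) else 0) = indicat_real (ball x r) y *\<^sub>R g (t, y)" for t x y
    by (auto simp: indicator_def)
  ultimately show ?thesis
    using \<open>0 < r\<close> by (simp add: ball_average_def set_lebesgue_integral_def content_ball borel_measurable_scaleR)
qed

lemma norm_ball_average_le:
  fixes g :: "'a::euclidean_space \<Rightarrow> 'b::euclidean_space"
  assumes "g \<in> borel_measurable borel" "\<And>y. norm (g y) \<le> R" "0 < r"
  shows "norm (ball_average g r x) \<le> R"
  using ball_average_in_closed_convex[OF assms, of "cball 0 R" x] assms(2) by auto

lemma ball_average_tendsto:
  fixes g h :: "'a::euclidean_space \<Rightarrow> 'b::euclidean_space"
  assumes g: "g \<in> borel_measurable borel" "\<And>y. norm (g y) \<le> R"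
    and h: "continuous (at x) h" and ae: "AE y in lborel. y \<in> ball x \<delta> \<longrightarrow> g y = h y" and "0 < \<delta>"
    and r: "\<And>k. 0 < r k" "r \<longlonglongrightarrow> 0" and y: "y \<longlonglongrightarrow> x"
  shows "(\<lambda>k. ball_average g (r k) (y k)) \<longlonglongrightarrow> h x"
proof (rule tendstoI)
  fix e :: real assume "0 < e"
  then obtain d where d: "0 < d" "\<And>z. dist z x < d \<Longrightarrow> dist (h z) (h x) < e/2"
    using h[unfolded continuous_at_eps_delta, rule_format, of "e/2"] by auto
  have "0 < min d \<delta> / 2" using d \<open>0 < \<delta>\<close> by simp
  then have "\<forall>\<^sub>F k in sequentially. dist (y k) x < min d \<delta> / 2" "\<forall>\<^sub>F k in sequentially. dist (r k) 0 < min d \<delta> / 2"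
    by (rule tendstoD[OF y], rule tendstoD[OF r(2)])
  then show "\<forall>\<^sub>F k in sequentially. dist (ball_average g (r k) (y k)) (h x) < e"
  proof eventually_elim
    case (elim k)
    have sub: "dist z x < min d \<delta>" if "z \<in> ball (y k) (r k)" for z
      using elim that dist_triangle[of z x "y k"] r(1)[of k] by (auto simp: dist_commute)
    have "AE z in lborel. z \<in> ball (y k) (r k) \<longrightarrow> g z \<in> cball (h x) (e/2)"
      using ae
    proof eventually_elim
      case (elim z)
      then show ?case using sub[of z] d(2)[of z] by (auto simp: dist_commute)
    qed
    then have "ball_average g (r k) (y k) \<in> cball (h x) (e/2)"
      by (intro ball_average_in_closed_convex[OF g r(1)]) auto
    then show ?case using \<open>0 < e\<close> by (simp add: dist_commute)
  qed
qed

section \<open>Convex combinations of tails of a sequence\<close>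

text \<open>The weights have finite support in \<open>{k..}\<close>. They are kept apart from the vectors since the same
  weights are applied to controls, right-hand sides and trajectories.\<close>

definition tail_weights :: "nat \<Rightarrow> (nat \<Rightarrow> real) \<Rightarrow> bool" where
  "tail_weights k c \<longleftrightarrow> finite {j. c j \<noteq> 0} \<and> (\<forall>j. 0 \<le> c j) \<and> (\<forall>j<k. c j = 0) \<and>
     (\<Sum>j | c j \<noteq> 0. c j) = 1"

definition weighted_sum :: "(nat \<Rightarrow> real) \<Rightarrow> (nat \<Rightarrow> 'a::real_vector) \<Rightarrow> 'a" where
  "weighted_sum c v = (\<Sum>j | c j \<noteq> 0. c j *\<^sub>R v j)"

lemma weighted_sum_superset:
  assumes "finite S" "{j. c j \<noteq> 0} \<subseteq> S"
  shows "weighted_sum c v = (\<Sum>j\<in>S. c j *\<^sub>R v j)"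
  unfolding weighted_sum_def by (rule sum.mono_neutral_left) (use assms in auto)

lemma tail_weights_mono: "tail_weights k c \<Longrightarrow> l \<le> k \<Longrightarrow> tail_weights l c"
  by (auto simp: tail_weights_def)

lemma tail_weights_single: "tail_weights k (\<lambda>j. if j = k then 1 else 0)"
  by (auto simp: tail_weights_def if_distrib cong: if_cong)

lemma tail_weights_midpoint:
  assumes c: "tail_weights k c" and d: "tail_weights k d"
  shows "tail_weights k (\<lambda>j. (c j + d j) / 2)"
    and "weighted_sum (\<lambda>j. (c j + d j) / 2) v = (weighted_sum c v + weighted_sum d v) /\<^sub>R 2"
proof -
  let ?e = "\<lambda>j. (c j + d j) / 2" and ?S = "{j. c j \<noteq> 0} \<union> {j. d j \<noteq> 0}"
  have S: "finite ?S" using c d by (simp add: tail_weights_def)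
  have eS: "{j. ?e j \<noteq> 0} \<subseteq> ?S" by auto
  show ws: "weighted_sum ?e v = (weighted_sum c v + weighted_sum d v) /\<^sub>R 2" for v :: "nat \<Rightarrow> 'z::real_vector"
  proof -
    have "weighted_sum ?e v = (\<Sum>j\<in>?S. ((c j + d j) / 2) *\<^sub>R v j)"
      using weighted_sum_superset[OF S eS] .
    also have "\<dots> = (\<Sum>j\<in>?S. (c j *\<^sub>R v j + d j *\<^sub>R v j) /\<^sub>R 2)"
    proof (rule sum.cong[OF refl])
      fix j
      have "(c j *\<^sub>R v j + d j *\<^sub>R v j) /\<^sub>R 2 = (inverse 2 * (c j + d j)) *\<^sub>R v j"
        by (simp only: scaleR_left_distrib[symmetric] scaleR_scaleR)
      then show "((c j + d j) / 2) *\<^sub>R v j = (c j *\<^sub>R v j + d j *\<^sub>R v j) /\<^sub>R 2"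
        by (simp only: divide_inverse mult.commute)
    qed
    also have "\<dots> = ((\<Sum>j\<in>?S. c j *\<^sub>R v j) + (\<Sum>j\<in>?S. d j *\<^sub>R v j)) /\<^sub>R 2"
      by (simp add: scaleR_sum_right[symmetric] sum.distrib del: scaleR_add_right)
    also have "(\<Sum>j\<in>?S. c j *\<^sub>R v j) = weighted_sum c v"
      by (rule weighted_sum_superset[OF S, symmetric]) auto
    also have "(\<Sum>j\<in>?S. d j *\<^sub>R v j) = weighted_sum d v"
      by (rule weighted_sum_superset[OF S, symmetric]) auto
    finally show ?thesis .
  qed
  have "(\<Sum>j | ?e j \<noteq> 0. ?e j) = 1"
    using ws[of "\<lambda>_. 1::real"] c d by (simp add: weighted_sum_def tail_weights_def)
  then show "tail_weights k ?e"
    using c d finite_subset[OF eS S] by (auto simp: tail_weights_def)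
qed

lemma weighted_sum_in_convex:
  assumes c: "tail_weights k c" and C: "convex C" and v: "\<And>j. k \<le> j \<Longrightarrow> v j \<in> C"
  shows "weighted_sum c v \<in> C"
  unfolding weighted_sum_def
proof (rule convex_sum[OF _ C])
  fix j assume "j \<in> {j. c j \<noteq> 0}"
  then have "k \<le> j" using c by (force simp: tail_weights_def not_less[symmetric])
  then show "v j \<in> C" by (rule v)
qed (use c in \<open>auto simp: tail_weights_def\<close>)

lemma norm_weighted_sum_le:
  fixes v :: "nat \<Rightarrow> 'a::real_normed_vector"
  assumes "tail_weights k c" "\<And>j. k \<le> j \<Longrightarrow> norm (v j) \<le> R"
  shows "norm (weighted_sum c v) \<le> R"
  using weighted_sum_in_convex[of k c "cball 0 R" v] assms by auto

lemma weighted_sum_const: "tail_weights k c \<Longrightarrow> weighted_sum c (\<lambda>_. z) = z"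
  by (simp add: weighted_sum_def tail_weights_def scaleR_sum_left[symmetric])

lemma weighted_sum_add: "weighted_sum c (\<lambda>j. v j + w j) = weighted_sum c v + weighted_sum c w"
  by (simp add: weighted_sum_def scaleR_add_right sum.distrib)

lemma weighted_sum_linear: "linear f \<Longrightarrow> weighted_sum c (\<lambda>j. f (v j)) = f (weighted_sum c v)"
  by (simp add: weighted_sum_def linear_sum linear_scale)

text \<open>Weights supported in \<open>{k..}\<close> see only the tail of the sequence, and balls are convex.\<close>

lemma weighted_sums_tendsto:
  fixes v :: "nat \<Rightarrow> 'a::real_normed_vector"
  assumes c: "\<And>k. tail_weights k (c k)" and v: "v \<longlonglongrightarrow> l"
  shows "(\<lambda>k. weighted_sum (c k) v) \<longlonglongrightarrow> l"
proof (rule LIMSEQ_I)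
  fix e :: real assume "0 < e"
  then obtain N where N: "\<And>j. N \<le> j \<Longrightarrow> norm (v j - l) < e"
    using LIMSEQ_D[OF v] by blast
  have "norm (weighted_sum (c k) v - l) < e" if "N \<le> k" for k
    using weighted_sum_in_convex[OF c[of k], of "ball l e" v] N that
    by (auto simp: dist_norm norm_minus_commute)
  then show "\<exists>N. \<forall>k\<ge>N. norm (weighted_sum (c k) v - l) < e" by blast
qed

text \<open>On a finite measure space \<open>L\<^sup>2\<close> controls \<open>L\<^sup>1\<close>: the increments have a finite sum of \<open>L\<^sup>1\<close> norms, so
  the sequence has bounded variation at almost every point.\<close>

lemma AE_convergent_of_summable_L2_increments:
  fixes f :: "nat \<Rightarrow> 'a \<Rightarrow> 'b::euclidean_space"
  assumes "finite_measure M"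
    and f[measurable]: "\<And>i. f i \<in> borel_measurable M"
    and int: "\<And>i. integrable M (\<lambda>x. (norm (f (Suc i) x - f i x))\<^sup>2)"
    and le: "\<And>i. (\<integral>x. (norm (f (Suc i) x - f i x))\<^sup>2 \<partial>M) \<le> (1/4)^i"
  shows "AE x in M. convergent (\<lambda>i. f i x)"
proof -
  interpret finite_measure M by fact
  define D where "D i x = norm (f (Suc i) x - f i x)" for i x
  have [measurable]: "D i \<in> borel_measurable M" for i unfolding D_def by measurable
  have bound: "(\<integral>\<^sup>+x. ennreal (D i x) \<partial>M) \<le> ennreal ((1/2)^i * (measure M (space M) + 1))" for i
  proof -
    \<comment> \<open>The elementary bound \<open>s \<le> c + s\<^sup>2 / c\<close> for \<open>c = (1/2)^i\<close>, which balances both terms to order \<open>(1/2)^i\<close>.\<close>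
    have pw: "D i x \<le> (1/2)^i + 2^i * (D i x)\<^sup>2" for x
    proof -
      have "0 \<le> ((1/2)^i - D i x)\<^sup>2 + (1/2)^i * D i x" by (simp add: D_def)
      also have "\<dots> = ((1/2)^i)\<^sup>2 + (D i x)\<^sup>2 - (1/2)^i * D i x" by (simp add: power2_diff)
      finally have "2^i * ((1/2)^i * D i x) \<le> 2^i * (((1/2)^i)\<^sup>2 + (D i x)\<^sup>2)"
        by (intro mult_left_mono) auto
      moreover have "2^i * ((1/2)^i * D i x) = D i x" "2^i * ((1/2)^i)\<^sup>2 = ((1/2::real)^i)"
        by (simp_all add: power_one_over power2_eq_square)
      ultimately show ?thesis by (simp add: distrib_left)
    qed
    have int': "integrable M (\<lambda>x. (1/2)^i + 2^i * (D i x)\<^sup>2)"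
      using int[of i] by (simp add: D_def)
    have "(\<integral>\<^sup>+x. ennreal (D i x) \<partial>M) \<le> (\<integral>\<^sup>+x. ennreal ((1/2)^i + 2^i * (D i x)\<^sup>2) \<partial>M)"
      by (intro nn_integral_mono ennreal_leI pw)
    also have "\<dots> = ennreal (\<integral>x. (1/2)^i + 2^i * (D i x)\<^sup>2 \<partial>M)"
      by (rule nn_integral_eq_integral[OF int']) auto
    also have "\<dots> \<le> ennreal ((1/2)^i * (measure M (space M) + 1))"
    proof (rule ennreal_leI)
      have "(\<integral>x. (1/2)^i + 2^i * (D i x)\<^sup>2 \<partial>M) = (1/2)^i * measure M (space M) + 2^i * (\<integral>x. (D i x)\<^sup>2 \<partial>M)"
        using int[of i] by (simp add: D_def mult.commute)
      also have "\<dots> \<le> (1/2)^i * measure M (space M) + 2^i * (1/4)^i"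
        using le[of i] by (simp add: D_def)
      also have "2^i * (1/4)^i = (1/2::real)^i" by (simp add: power_mult_distrib[symmetric])
      finally show "(\<integral>x. (1/2)^i + 2^i * (D i x)\<^sup>2 \<partial>M) \<le> (1/2)^i * (measure M (space M) + 1)"
        by (simp add: distrib_left)
    qed
    finally show ?thesis .
  qed
  have sm: "summable (\<lambda>i. (1/2)^i * (measure M (space M) + 1))"
    by (intro summable_mult2 summable_geometric) simp
  have "(\<integral>\<^sup>+x. (\<Sum>i. ennreal (D i x)) \<partial>M) = (\<Sum>i. \<integral>\<^sup>+x. ennreal (D i x) \<partial>M)"
    by (rule nn_integral_suminf) measurable
  also have "\<dots> \<le> (\<Sum>i. ennreal ((1/2)^i * (measure M (space M) + 1)))"
    by (intro suminf_le bound summableI)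
  also have "\<dots> = ennreal (\<Sum>i. (1/2)^i * (measure M (space M) + 1))"
    using sm by (intro suminf_ennreal2) auto
  finally have "(\<integral>\<^sup>+x. (\<Sum>i. ennreal (D i x)) \<partial>M) \<noteq> \<infinity>"
    by (auto simp: top_unique)
  then have "AE x in M. (\<Sum>i. ennreal (D i x)) \<noteq> \<infinity>"
    by (intro nn_integral_PInf_AE) auto
  then show ?thesis
  proof eventually_elim
    case (elim x)
    then have "summable (\<lambda>i. D i x)"
      by (intro summable_suminf_not_top) (auto simp: D_def)
    then have "summable (\<lambda>i. f (Suc i) x - f i x)"
      unfolding D_def by (rule summable_norm_cancel)
    then have "convergent (\<lambda>n. f 0 x + (\<Sum>i<n. f (Suc i) x - f i x))"
      by (intro convergent_add convergent_const) (simp add: summable_iff_convergent)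
    then show ?case by (simp add: sum_lessThan_telescope[of "\<lambda>i. f i x"])
  qed
qed

lemma parallelogram_identity:
  fixes a b :: "'a::real_inner"
  shows "(norm (a + b))\<^sup>2 + (norm (a - b))\<^sup>2 = 2 * (norm a)\<^sup>2 + 2 * (norm b)\<^sup>2"
  by (simp add: power2_norm_eq_inner inner_add_left inner_add_right inner_diff_left inner_diff_right)

text \<open>This replaces weak compactness together with Mazur's lemma. The infimum \<open>d k\<close> of the squared \<open>L\<^sup>2\<close>
  norm over the convex combinations of \<open>v k, v (k+1), \<dots>\<close> increases with \<open>k\<close> and is bounded. For
  almost minimizers \<open>c k\<close> and \<open>c l\<close> with \<open>k \<le> l\<close> the midpoint still competes for \<open>d k\<close>, so the
  parallelogram law bounds their distance by \<open>d l - d k\<close> and the minimization errors. A fast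
  subsequence then converges almost everywhere.\<close>

lemma convex_tails_AE_convergent:
  fixes v :: "nat \<Rightarrow> 'a \<Rightarrow> 'b::euclidean_space"
  assumes "finite_measure M"
    and v[measurable]: "\<And>j. v j \<in> borel_measurable M" and R: "\<And>j x. norm (v j x) \<le> R"
  obtains c where "\<And>k. tail_weights k (c k)" "AE x in M. convergent (\<lambda>k. weighted_sum (c k) (\<lambda>j. v j x))"
proof -
  interpret finite_measure M by fact
  define W where "W c x = weighted_sum c (\<lambda>j. v j x)" for c x
  define N where "N c = (\<integral>x. (norm (W c x))\<^sup>2 \<partial>M)" for c
  have W[measurable]: "W c \<in> borel_measurable M" for c
    unfolding W_def weighted_sum_def by measurable
  have R0: "0 \<le> R" using order_trans[OF norm_ge_zero R] .
  have WR: "norm (W c x) \<le> R" if "tail_weights k c" for k c x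
    unfolding W_def by (rule norm_weighted_sum_le[OF that R])
  have sq: "integrable M (\<lambda>x. (norm (g x))\<^sup>2)" if "g \<in> borel_measurable M" "\<And>x. norm (g x) \<le> B"
    for g :: "'a \<Rightarrow> 'b" and B
    using that by (intro integrable_const_bound[where B="B\<^sup>2"]) (auto intro!: power_mono)
  have intW: "integrable M (\<lambda>x. (norm (W c x))\<^sup>2)" if "tail_weights k c" for k c
    by (rule sq[OF W WR[OF that]])
  define d where "d k = Inf (N ` {c. tail_weights k c})" for k
  have N0: "0 \<le> N c" for c unfolding N_def by simp
  have bdd: "bdd_below (N ` {c. tail_weights k c})" for k
    using N0 by (intro bdd_belowI[of _ 0]) auto
  have d_le: "d k \<le> N c" if "tail_weights k c" for k c
    unfolding d_def using that by (intro cInf_lower bdd) auto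
  have d_mono: "d k \<le> d l" if "k \<le> l" for k l
    unfolding d_def using tail_weights_mono[OF _ that] tail_weights_single[of l]
    by (intro cInf_superset_mono bdd) auto
  have d_up: "d k \<le> R\<^sup>2 * measure M (space M)" for k
  proof -
    have tw: "tail_weights k (\<lambda>j. if j = k then 1 else 0)" by (rule tail_weights_single)
    have "N (\<lambda>j. if j = k then 1 else 0) \<le> (\<integral>x. R\<^sup>2 \<partial>M)"
      unfolding N_def using WR[OF tw] by (intro integral_mono intW[OF tw]) (auto intro!: power_mono)
    then show ?thesis using d_le[OF tw] by (simp add: mult.commute)
  qed
  define \<eta> where "\<eta> k = inverse (real (Suc k))" for k
  have \<eta>_anti: "\<eta> l \<le> \<eta> k" if "k \<le> l" for k l using that by (simp add: \<eta>_def)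
  have \<eta>_pos: "0 < \<eta> k" for k by (simp add: \<eta>_def)
  have "\<exists>c. tail_weights k c \<and> N c < d k + \<eta> k" for k
    using cInf_lessD[of "N ` {c. tail_weights k c}" "d k + \<eta> k"] tail_weights_single[of k] \<eta>_pos[of k]
    by (auto simp: d_def)
  then obtain c where c: "\<And>k. tail_weights k (c k)" "\<And>k. N (c k) < d k + \<eta> k"
    by metis
  \<comment> \<open>Squared \<open>L\<^sup>2\<close> distance of two almost minimizers, with \<open>\<eta>\<close> the allowed minimization error.\<close>
  define I where "I l k = (\<integral>x. (norm (W (c l) x - W (c k) x))\<^sup>2 \<partial>M)" for l k
  have dist: "I l k \<le> 2 * (d l - d k) + 4 * \<eta> k"
    if "k \<le> l" for k l
  proof -
    note tl = tail_weights_mono[OF c(1)[of l] that]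
    note mid = tail_weights_midpoint[OF tl c(1)[of k]]
    let ?e = "\<lambda>j. (c l j + c k j) / 2"
    have e: "W ?e x = (W (c l) x + W (c k) x) /\<^sub>R 2" for x unfolding W_def by (rule mid)
    have "4 * (norm (W ?e x))\<^sup>2 = (norm (W (c l) x + W (c k) x))\<^sup>2" for x
      by (simp add: e power_mult_distrib power_divide)
    then have "(norm (W (c l) x - W (c k) x))\<^sup>2 =
        2 * (norm (W (c l) x))\<^sup>2 + 2 * (norm (W (c k) x))\<^sup>2 - 4 * (norm (W ?e x))\<^sup>2" for x
      using parallelogram_identity[of "W (c l) x" "W (c k) x"] by simp
    then have "I l k = 2 * N (c l) + 2 * N (c k) - 4 * N ?e"
      using intW[OF c(1)[of l]] intW[OF c(1)[of k]] intW[OF mid(1)] by (simp add: N_def I_def)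
    moreover have "\<eta> l \<le> \<eta> k" by (rule \<eta>_anti[OF that])
    ultimately show ?thesis using d_le[OF mid(1)] c(2)[of k] c(2)[of l] by argo
  qed
  have "incseq d" using d_mono by (simp add: incseq_def)
  then have conv: "convergent d" using d_up by (metis incseq_convergent convergentI)
  define I where "I l k = (\<integral>x. (norm (W (c l) x - W (c k) x))\<^sup>2 \<partial>M)" for l k
  have dist: "I l k \<le> 2 * (d l - d k) + 4 * \<eta> k"
    if "k \<le> l" for k l
  proof -
    note tl = tail_weights_mono[OF c(1)[of l] that]
    note mid = tail_weights_midpoint[OF tl c(1)[of k]]
    let ?e = "\<lambda>j. (c l j + c k j) / 2"
    have e: "W ?e x = (W (c l) x + W (c k) x) /\<^sub>R 2" for x unfolding W_def by (rule mid)
    have "4 * (norm (W ?e x))\<^sup>2 = (norm (W (c l) x + W (c k) x))\<^sup>2" for x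
      by (simp add: e power_mult_distrib power_divide)
    then have "(norm (W (c l) x - W (c k) x))\<^sup>2 =
        2 * (norm (W (c l) x))\<^sup>2 + 2 * (norm (W (c k) x))\<^sup>2 - 4 * (norm (W ?e x))\<^sup>2" for x
      using parallelogram_identity[of "W (c l) x" "W (c k) x"] by simp
    then have "I l k = 2 * N (c l) + 2 * N (c k) - 4 * N ?e"
      using intW[OF c(1)[of l]] intW[OF c(1)[of k]] intW[OF mid(1)] by (simp add: N_def I_def)
    moreover have "\<eta> l \<le> \<eta> k" by (rule \<eta>_anti[OF that])
    ultimately show ?thesis using d_le[OF mid(1)] c(2)[of k] c(2)[of l] by argo
  qed
  have conv: "convergent d"
    using Bseq_mono_convergent[of d] d_mono d_up N0 BseqI'[of d "max (R\<^sup>2 * measure M (space M)) \<bar>d 0\<bar>"] d_mono[of 0]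
    by (smt (verit) incseq_convergent incseq_def convergent_def)
  have small: "\<exists>K. \<forall>k\<ge>K. \<forall>l\<ge>k. I l k \<le> e" if "0 < e" for e
  proof -
    have "Cauchy d" using conv by (simp add: Cauchy_convergent_iff)
    then obtain K1 where K1: "\<And>m n. K1 \<le> m \<Longrightarrow> K1 \<le> n \<Longrightarrow> norm (d m - d n) < e/4"
      using CauchyD[of d "e/4"] \<open>0 < e\<close> by auto
    obtain K2 where K2: "\<eta> K2 < e/8" using reals_Archimedean[of "e/8"] \<open>0 < e\<close> by (auto simp: \<eta>_def)
    have "I l k \<le> e" if "max K1 K2 \<le> k" "k \<le> l" for k l
    proof -
      have "\<eta> k \<le> \<eta> K2" using that by (intro \<eta>_anti) simp
      moreover have "norm (d l - d k) < e/4" using K1[of l k] that by simp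
      ultimately show ?thesis using dist[OF that(2)] K2 unfolding real_norm_def by argo
    qed
    then show ?thesis by blast
  qed
  have "\<exists>K. \<forall>i. (\<forall>l\<ge>K i. I l (K i) \<le> (1/4)^i) \<and> K i < K (Suc i)"
  proof (rule dependent_nat_choice)
    show "\<exists>k. \<forall>l\<ge>k. I l k \<le> (1/4)^0"
      using small[of 1] by auto
    fix k :: nat and i
    obtain K where "\<forall>k\<ge>K. \<forall>l\<ge>k. I l k \<le> (1/4)^(Suc i)"
      using small[of "(1/4)^(Suc i)"] by auto
    then show "\<exists>k'. (\<forall>l\<ge>k'. I l k' \<le> (1/4)^Suc i) \<and> k < k'"
      by (intro exI[of _ "max K (Suc k)"]) auto
  qed
  then obtain K where K: "\<And>i l. K i \<le> l \<Longrightarrow> I l (K i) \<le> (1/4)^i"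
    "\<And>i. K i < K (Suc i)" by blast
  \<comment> \<open>Passing to the subsequence keeps the \<open>i\<close>-th combination in the \<open>i\<close>-th tail.\<close>
  have Ki: "i \<le> K i" for i
    using K(2) by (intro seq_suble) (simp add: strict_mono_Suc_iff)
  show thesis
  proof (rule that[of "\<lambda>i. c (K i)"])
    show "tail_weights i (c (K i))" for i by (rule tail_weights_mono[OF c(1) Ki])
    have "AE x in M. convergent (\<lambda>i. W (c (K i)) x)"
    proof (rule AE_convergent_of_summable_L2_increments[OF assms(1) W])
      fix i
      show "integrable M (\<lambda>x. (norm (W (c (K (Suc i))) x - W (c (K i)) x))\<^sup>2)"
        using WR[OF c(1)] by (intro sq[where B="R + R"] norm_triangle_le_diff add_mono) auto
      show "(\<integral>x. (norm (W (c (K (Suc i))) x - W (c (K i)) x))\<^sup>2 \<partial>M) \<le> (1/4)^i"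
        using K(1)[of i "K (Suc i)"] K(2)[of i] by (simp add: I_def)
    qed
    then show "AE x in M. convergent (\<lambda>i. weighted_sum (c (K i)) (\<lambda>j. v j x))" by (simp add: W_def)
  qed
qed

section \<open>Matrix-vector products\<close>

lemma bounded_bilinear_matrix_vector_mult:
  "bounded_bilinear ((*v) :: real^'m^'n \<Rightarrow> real^'m \<Rightarrow> real^'n)"
  unfolding bilinear_conv_bounded_bilinear[symmetric] bilinear_def
  by (auto intro!: linearI simp: matrix_vector_mult_add_rdistrib matrix_vector_right_distrib
      matrix_vector_mult_scaleR scaleR_matrix_vector_assoc)

lemma norm_matrix_vector_mult_le:
  fixes A :: "real^'m^'n" and v :: "real^'m"
  shows "norm (A *v v) \<le> norm A * norm v"
proof -
  have "norm (A *v v) = L2_set (\<lambda>i. norm ((A $ i) \<bullet> v)) UNIV"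
    by (simp add: norm_vec_def matrix_vector_mul_component)
  also have "\<dots> \<le> L2_set (\<lambda>i. norm (A $ i) * norm v) UNIV"
    by (intro L2_set_mono) (auto simp: Cauchy_Schwarz_ineq2)
  also have "\<dots> = norm A * norm v"
    by (simp add: norm_vec_def L2_set_left_distrib)
  finally show ?thesis .
qed

lemma borel_measurable_matrix_vector_mult [measurable (raw)]:
  fixes A :: "'a \<Rightarrow> real^'m^'n" and v :: "'a \<Rightarrow> real^'m"
  assumes "A \<in> borel_measurable M" "v \<in> borel_measurable M"
  shows "(\<lambda>x. A x *v v x) \<in> borel_measurable M"
proof (rule borel_measurable_continuous_Pair[OF assms])
  show "continuous_on UNIV (\<lambda>p::(real^'m^'n) \<times> (real^'m). fst p *v snd p)"
    by (intro bounded_bilinear.continuous_on[OF bounded_bilinear_matrix_vector_mult] continuous_intros)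
qed

section \<open>Integral equations with a delay\<close>

lemma norm_set_lebesgue_integral_le:
  fixes g :: "'a::euclidean_space \<Rightarrow> 'b::euclidean_space"
  assumes "S \<in> sets borel" "emeasure lborel S < \<infinity>" "\<And>s. s \<in> S \<Longrightarrow> norm (g s) \<le> L" "0 \<le> L"
  shows "norm (LINT s:S|lborel. g s) \<le> L * measure lborel S"
proof -
  have "norm (LINT s:S|lborel. g s) \<le> (\<integral>s. norm (indicat_real S s *\<^sub>R g s) \<partial>lborel)"
    unfolding set_lebesgue_integral_def by (rule integral_norm_bound)
  also have "\<dots> \<le> (\<integral>s. L * indicat_real S s \<partial>lborel)"
    using assms
    by (intro integral_mono_AE' integrable_mult_right integrable_real_indicator) (auto simp: indicator_def intro!: AE_I2)
  also have "\<dots> = L * measure lborel S" using assms(1) by simp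
  finally show ?thesis .
qed

lemma indefinite_integral_lipschitz:
  fixes g :: "real \<Rightarrow> 'b::euclidean_space"
  assumes g: "g \<in> borel_measurable borel" "\<And>s. norm (g s) \<le> L"
  shows "norm ((LINT s:{a..t}|lborel. g s) - (LINT s:{a..r}|lborel. g s)) \<le> L * \<bar>t - r\<bar>"
proof -
  have L: "0 \<le> L" using order_trans[OF norm_ge_zero g(2)] .
  have int: "set_integrable lborel S g" if "S \<in> sets borel" "emeasure lborel S < \<infinity>" for S
    using bounded_set_integrable_lborel[OF g that] .
  have *: "norm ((LINT s:{a..t}|lborel. g s) - (LINT s:{a..r}|lborel. g s)) \<le> L * (t - r)" if "r \<le> t" for r t
  proof -
    let ?D = "{a..t} - {a..r}"
    have D: "?D \<in> sets borel" "?D \<subseteq> {r..t}" by auto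
    have Dm: "emeasure lborel ?D \<le> ennreal (t - r)"
      using emeasure_mono[OF D(2), of lborel] that by simp
    have Df: "emeasure lborel ?D < \<infinity>" using le_less_trans[OF Dm] by simp
    have "{a..t} = {a..r} \<union> ?D" using that by auto
    then have "(LINT s:{a..t}|lborel. g s) = (LINT s:{a..r} \<union> ?D|lborel. g s)" by simp
    also have "\<dots> = (LINT s:{a..r}|lborel. g s) + (LINT s:?D|lborel. g s)"
      by (intro set_integral_Un int D(1) Df) (auto simp: emeasure_lborel_Icc_eq)
    finally have "norm ((LINT s:{a..t}|lborel. g s) - (LINT s:{a..r}|lborel. g s)) = norm (LINT s:?D|lborel. g s)"
      by simp
    also have "\<dots> \<le> L * measure lborel ?D"
      by (rule norm_set_lebesgue_integral_le[OF D(1) Df g(2) L])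
    also have "measure lborel ?D \<le> t - r"
      using Dm that by (simp add: measure_def enn2real_leI)
    finally show ?thesis using L by (simp add: mult_left_mono)
  qed
  show ?thesis
  proof (cases "r \<le> t")
    case True then show ?thesis using *[of r t] by simp
  next
    case False then show ?thesis using *[of t r] by (simp add: norm_minus_commute)
  qed
qed

text \<open>Tonelli's approximation scheme. Up to time \<open>t0 + h\<close> the right-hand side involves only the constant
  initial history, so integrating yields \<open>x\<close> there, then up to \<open>t0 + 2 h\<close>, and so on. In terms of the
  integral operator \<open>\<Gamma>\<close>: the iterates \<open>X j\<close> and \<open>X (j + 1)\<close> agree up to time \<open>t0 + j h\<close>, so after
  finitely many steps they agree on the whole interval.\<close>

lemma delayed_integral_equation_solution:
  fixes G :: "(real \<Rightarrow> 'a::euclidean_space) \<Rightarrow> real \<Rightarrow> 'a"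
  assumes h: "0 < h"
    and causal: "\<And>y z s. (\<And>\<tau>. \<tau> \<le> s \<Longrightarrow> y \<tau> = z \<tau>) \<Longrightarrow> G y s = G z s"
    and meas: "\<And>y. y \<in> borel_measurable borel \<Longrightarrow> G y \<in> borel_measurable borel"
    and bound: "\<And>y s. y \<in> borel_measurable borel \<Longrightarrow> norm (G y s) \<le> L"
  obtains x where "\<And>t. t \<le> t0 \<Longrightarrow> x t = x0" "\<And>s t. norm (x t - x s) \<le> L * \<bar>t - s\<bar>"
    "\<And>t. t \<le> T \<Longrightarrow> x t = x0 + (LINT s:{t0..t}|lborel. G (\<lambda>\<tau>. x (\<tau> - h)) s)"
proof -
  define \<Gamma> where "\<Gamma> z t = x0 + (LINT s:{t0..t}|lborel. G (\<lambda>\<tau>. z (\<tau> - h)) s)" for z t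
  define X where "X j = (\<Gamma> ^^ j) (\<lambda>_. x0)" for j
  have X: "X 0 = (\<lambda>_. x0)" "X (Suc j) = \<Gamma> (X j)" for j by (simp_all add: X_def)
  have L: "0 \<le> L" using order_trans[OF norm_ge_zero bound[of "\<lambda>_. x0"]] by simp
  have lip: "norm (X j t - X j s) \<le> L * \<bar>t - s\<bar>" and Xm: "X j \<in> borel_measurable borel" for j s t
  proof -
    have "(\<forall>s t. norm (X j t - X j s) \<le> L * \<bar>t - s\<bar>) \<and> X j \<in> borel_measurable borel"
    proof (induction j)
      case 0 show ?case using L by (simp add: X)
    next
      case (Suc j)
      have [measurable]: "X j \<in> borel_measurable borel" using Suc by simp
      have dm: "(\<lambda>\<tau>. X j (\<tau> - h)) \<in> borel_measurable borel" by measurable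
      have l: "\<forall>s t. norm (X (Suc j) t - X (Suc j) s) \<le> L * \<bar>t - s\<bar>"
        using indefinite_integral_lipschitz[OF meas[OF dm] bound[OF dm]] by (simp add: X \<Gamma>_def)
      then have "L-lipschitz_on UNIV (X (Suc j))"
        using L by (auto intro!: lipschitz_onI simp: dist_norm)
      then show ?case
        using l by (auto intro!: borel_measurable_continuous_onI lipschitz_on_continuous_on)
    qed
    then show "norm (X j t - X j s) \<le> L * \<bar>t - s\<bar>" "X j \<in> borel_measurable borel" by auto
  qed
  have start: "X j t = x0" if "t \<le> t0" for j t
  proof (cases j)
    case (Suc i)
    have "(LINT s:{t0..t}|lborel. g s) = 0" for g :: "real \<Rightarrow> 'a"
    proof (cases "t = t0")
      case True
      have "AE s in lborel. indicat_real {t0..t} s *\<^sub>R g s = 0"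
        using AE_lborel_singleton[of t0] by eventually_elim (auto simp: True)
      then show ?thesis unfolding set_lebesgue_integral_def by (rule integral_eq_zero_AE)
    qed (use that in \<open>auto simp: set_lebesgue_integral_def\<close>)
    then show ?thesis by (simp add: Suc X \<Gamma>_def)
  qed (simp add: X)
  have agree: "X (Suc j) t = X j t" if "t \<le> t0 + real j * h" for j t
    using that
  proof (induction j arbitrary: t)
    case 0 then show ?case by (simp add: start)
  next
    case (Suc j)
    have "G (\<lambda>\<tau>. X (Suc j) (\<tau> - h)) s = G (\<lambda>\<tau>. X j (\<tau> - h)) s" if "s \<in> {t0..t}" for s
    proof (rule causal)
      fix \<tau> assume "\<tau> \<le> s"
      then have "\<tau> - h \<le> t0 + real j * h" using that Suc.prems by (simp add: algebra_simps)
      then show "X (Suc j) (\<tau> - h) = X j (\<tau> - h)" by (rule Suc.IH)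
    qed
    then have "\<Gamma> (X (Suc j)) t = \<Gamma> (X j) t"
      unfolding \<Gamma>_def by (intro arg_cong[where f="\<lambda>z. x0 + z"] set_lebesgue_integral_cong) auto
    then show ?case by (simp add: X)
  qed
  obtain j where j: "T - t0 < real j * h" using ex_less_of_nat_mult[OF h] by blast
  show thesis
  proof (rule that[of "X j"])
    fix t assume "t \<le> T"
    then have "X j t = X (Suc j) t" using agree[of t j] j by simp
    then show "X j t = x0 + (LINT s:{t0..t}|lborel. G (\<lambda>\<tau>. X j (\<tau> - h)) s)" by (simp add: X \<Gamma>_def)
  qed (use start lip in auto)
qed

section \<open>Volterra integrals and limits of approximate solutions\<close>

lemma set_integral_tendsto_bounded:
  fixes g :: "nat \<Rightarrow> 'a::euclidean_space \<Rightarrow> 'b::euclidean_space"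
  assumes S: "S \<in> sets borel" "emeasure lborel S < \<infinity>"
    and g: "\<And>k. g k \<in> borel_measurable borel" "\<And>k s. s \<in> S \<Longrightarrow> norm (g k s) \<le> R"
    and f: "f \<in> borel_measurable borel"
    and lim: "AE s in lborel. s \<in> S \<longrightarrow> (\<lambda>k. g k s) \<longlonglongrightarrow> f s"
  shows "set_integrable lborel S f" "(\<lambda>k. LINT s:S|lborel. g k s) \<longlonglongrightarrow> (LINT s:S|lborel. f s)"
proof -
  have w: "integrable lborel (\<lambda>s. R * indicat_real S s)"
    using S by (intro integrable_mult_right integrable_real_indicator) auto
  have m: "(\<lambda>s. indicat_real S s *\<^sub>R f s) \<in> borel_measurable lborel"
    "\<And>k. (\<lambda>s. indicat_real S s *\<^sub>R g k s) \<in> borel_measurable lborel"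
    using S(1) f g(1) by measurable
  have l: "AE s in lborel. (\<lambda>k. indicat_real S s *\<^sub>R g k s) \<longlonglongrightarrow> indicat_real S s *\<^sub>R f s"
    using lim by eventually_elim (auto simp: indicator_def)
  have b: "\<And>k. AE s in lborel. norm (indicat_real S s *\<^sub>R g k s) \<le> R * indicat_real S s"
    using g(2) by (auto simp: indicator_def)
  show "set_integrable lborel S f"
    unfolding set_integrable_def by (rule integrable_dominated_convergence[OF m(1) m(2) w l b])
  show "(\<lambda>k. LINT s:S|lborel. g k s) \<longlonglongrightarrow> (LINT s:S|lborel. f s)"
    unfolding set_lebesgue_integral_def by (rule integral_dominated_convergence[OF m(1) m(2) w l b])
qed

lemma weighted_sum_set_integral:
  fixes g :: "nat \<Rightarrow> 'a \<Rightarrow> 'b::{banach, second_countable_topology}"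
  assumes "\<And>j. set_integrable M S (g j)"
  shows "weighted_sum c (\<lambda>j. LINT s:S|M. g j s) = (LINT s:S|M. weighted_sum c (\<lambda>j. g j s))"
proof -
  have "(LINT s:S|M. weighted_sum c (\<lambda>j. g j s)) =
      (\<integral>s. (\<Sum>j | c j \<noteq> 0. c j *\<^sub>R (indicator S s *\<^sub>R g j s)) \<partial>M)"
    unfolding set_lebesgue_integral_def weighted_sum_def
    by (simp add: scaleR_sum_right mult.commute)
  also have "\<dots> = weighted_sum c (\<lambda>j. LINT s:S|M. g j s)"
    using assms unfolding set_lebesgue_integral_def weighted_sum_def set_integrable_def
    by (subst Bochner_Integration.integral_sum) (auto simp del: scaleR_scaleR)
  finally show ?thesis by simp
qed

lemma borel_measurable_weighted_sum [measurable]: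
  fixes g :: "nat \<Rightarrow> 'a \<Rightarrow> 'b::{real_normed_vector, second_countable_topology}"
  assumes "\<And>j. g j \<in> borel_measurable M"
  shows "(\<lambda>s. weighted_sum c (\<lambda>j. g j s)) \<in> borel_measurable M"
  unfolding weighted_sum_def using assms by measurable

definition volterra :: "(real \<times> real \<Rightarrow> real^'n^'n) \<Rightarrow> real \<Rightarrow> (real \<Rightarrow> real^'n) \<Rightarrow> real \<Rightarrow> real^'n" where
  "volterra \<Phi> t0 h s = (LINT \<tau>:{t0..s}|lborel. \<Phi> (s, \<tau>) *v h \<tau>)"

lemma borel_measurable_section:
  fixes g :: "'a::euclidean_space \<times> 'b::euclidean_space \<Rightarrow> 'c::topological_space"
  assumes "g \<in> borel_measurable borel"
  shows "(\<lambda>y. g (t, y)) \<in> borel_measurable borel"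
  using assms by measurable

lemma borel_measurable_along_curve:
  fixes g :: "real \<times> 'b::euclidean_space \<Rightarrow> 'c::topological_space"
  assumes [measurable]: "g \<in> borel_measurable borel" "y \<in> borel_measurable borel"
  shows "(\<lambda>t. g (t, y t)) \<in> borel_measurable borel"
  by measurable

lemma borel_measurable_volterra:
  fixes \<Phi> :: "real \<times> real \<Rightarrow> real^'n^'n"
  assumes \<Phi>[measurable]: "\<Phi> \<in> borel_measurable borel" and h[measurable]: "h \<in> borel_measurable borel"
  shows "volterra \<Phi> t0 h \<in> borel_measurable borel"
proof -
  have "(\<lambda>(s, \<tau>). if t0 \<le> \<tau> \<and> \<tau> \<le> s then \<Phi> (s, \<tau>) *v h \<tau> else 0)
          \<in> borel_measurable ((borel :: real measure) \<Otimes>\<^sub>M (lborel :: real measure))"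
    by measurable
  then have "(\<lambda>s. \<integral>\<tau>. (if t0 \<le> \<tau> \<and> \<tau> \<le> s then \<Phi> (s, \<tau>) *v h \<tau> else 0) \<partial>lborel) \<in> borel_measurable (borel :: real measure)"
    by (rule lborel.borel_measurable_lebesgue_integral)
  moreover have "(if t0 \<le> \<tau> \<and> \<tau> \<le> s then \<Phi> (s, \<tau>) *v h \<tau> else 0) = indicat_real {t0..s} \<tau> *\<^sub>R (\<Phi> (s, \<tau>) *v h \<tau>)" for s \<tau>
    by (auto simp: indicator_def)
  ultimately show ?thesis
    by (simp add: volterra_def[abs_def] set_lebesgue_integral_def)
qed

text \<open>The kernel vanishes after time \<open>t0 + 1\<close>, so only an interval of length at most one contributes. This
  gives a bound for all times, as the step-by-step construction requires.\<close>

lemma norm_volterra_le: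
  fixes \<Phi> :: "real \<times> real \<Rightarrow> real^'n^'n"
  assumes \<Phi>: "\<And>z. norm (\<Phi> z) \<le> R" and h: "\<And>\<tau>. norm (h \<tau>) \<le> K"
    and zero: "\<And>s \<tau>. t0 + 1 < s \<Longrightarrow> \<Phi> (s, \<tau>) = 0"
  shows "norm (volterra \<Phi> t0 h s) \<le> R * K"
proof -
  have RK: "0 \<le> R" "0 \<le> K" using order_trans[OF norm_ge_zero \<Phi>] order_trans[OF norm_ge_zero h] .
  show ?thesis
  proof (cases "t0 + 1 < s")
    case True then show ?thesis using RK by (simp add: volterra_def zero)
  next
    case False
    have "norm (\<Phi> (s, \<tau>) *v h \<tau>) \<le> R * K" for \<tau>
      using norm_matrix_vector_mult_le[of "\<Phi> (s, \<tau>)" "h \<tau>"] mult_mono[OF \<Phi>[of "(s, \<tau>)"] h[of \<tau>]] RK by simp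
    then have "norm (volterra \<Phi> t0 h s) \<le> R * K * measure lborel {t0..s}"
      unfolding volterra_def using RK by (intro norm_set_lebesgue_integral_le) (auto simp: emeasure_lborel_Icc_eq)
    also have "\<dots> \<le> R * K * 1" using False RK by (intro mult_left_mono) (cases "t0 \<le> s", auto)
    finally show ?thesis by simp
  qed
qed

text \<open>The equation is linear in the pair \<open>(p, h)\<close>, so it passes to convex combinations. Combinations of
  tails of \<open>x j t\<close> have the limit \<open>X t\<close> of the sequence itself, whereas for \<open>p\<close> and \<open>h\<close> only the
  combinations need to converge; dominated convergence applies twice, first in the inner and then in
  the outer integral. The integrability claims are needed since \<open>P\<close> and \<open>H\<close> are bounded only almost
  everywhere.\<close>

lemma volterra_equation_limit:
  fixes p h :: "nat \<Rightarrow> real \<Rightarrow> real^'n"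
  assumes \<Phi>: "\<Phi> \<in> borel_measurable borel" "\<And>z. norm (\<Phi> z) \<le> R" "\<And>s \<tau>. t0 + 1 < s \<Longrightarrow> \<Phi> (s, \<tau>) = 0"
    and p: "\<And>j. p j \<in> borel_measurable borel" "\<And>j s. norm (p j s) \<le> K"
    and h: "\<And>j. h j \<in> borel_measurable borel" "\<And>j s. norm (h j s) \<le> K"
    and x: "\<And>j t. t \<in> {t0..T} \<Longrightarrow> x j t = x0 + (LINT s:{t0..t}|lborel. p j s + volterra \<Phi> t0 (h j) s)"
    and lim: "\<And>t. t \<in> {t0..T} \<Longrightarrow> (\<lambda>j. x j t) \<longlonglongrightarrow> X t"
    and c: "\<And>k. tail_weights k (c k)"
    and P: "P \<in> borel_measurable borel"
      "AE s in lborel. s \<in> {t0..T} \<longrightarrow> (\<lambda>k. weighted_sum (c k) (\<lambda>j. p j s)) \<longlonglongrightarrow> P s"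
    and H: "H \<in> borel_measurable borel"
      "AE s in lborel. s \<in> {t0..T} \<longrightarrow> (\<lambda>k. weighted_sum (c k) (\<lambda>j. h j s)) \<longlonglongrightarrow> H s"
    and t: "t \<in> {t0..T}"
  shows "set_integrable lborel {t0..t} (\<lambda>\<tau>. \<Phi> (t, \<tau>) *v H \<tau>)"
    and "set_integrable lborel {t0..t} (\<lambda>s. P s + volterra \<Phi> t0 H s)"
    and "X t = x0 + (LINT s:{t0..t}|lborel. P s + volterra \<Phi> t0 H s)"
proof -
  have R0: "0 \<le> R" "0 \<le> K" using order_trans[OF norm_ge_zero \<Phi>(2)] order_trans[OF norm_ge_zero p(2)] .
  define Pk where "Pk k s = weighted_sum (c k) (\<lambda>j. p j s)" for k s
  define Hk where "Hk k s = weighted_sum (c k) (\<lambda>j. h j s)" for k s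
  have Pk: "Pk k \<in> borel_measurable borel" "norm (Pk k s) \<le> K" for k s
    unfolding Pk_def using p(1) by (measurable, intro norm_weighted_sum_le[OF c p(2)])
  have Hk: "Hk k \<in> borel_measurable borel" "norm (Hk k s) \<le> K" for k s
    unfolding Hk_def using h(1) by (measurable, intro norm_weighted_sum_le[OF c h(2)])
  have \<Phi>h: "(\<lambda>\<tau>. \<Phi> (s, \<tau>) *v f \<tau>) \<in> borel_measurable borel" if "f \<in> borel_measurable borel" for f s
    using borel_measurable_section[OF \<Phi>(1)] that by measurable
  have \<Phi>b: "norm (\<Phi> (s, \<tau>) *v v) \<le> R * K" if "norm v \<le> K" for v s \<tau>
    using norm_matrix_vector_mult_le[of "\<Phi> (s, \<tau>)" v] mult_mono[OF \<Phi>(2)[of "(s, \<tau>)"] that] R0 by simp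
  have fin: "emeasure lborel {t0..s} < \<infinity>" for s :: real by (simp add: emeasure_lborel_Icc_eq)
  have vs: "weighted_sum (c k) (\<lambda>j. volterra \<Phi> t0 (h j) s) = volterra \<Phi> t0 (Hk k) s" for k s
  proof -
    have "weighted_sum (c k) (\<lambda>j. volterra \<Phi> t0 (h j) s) =
        (LINT \<tau>:{t0..s}|lborel. weighted_sum (c k) (\<lambda>j. \<Phi> (s, \<tau>) *v h j \<tau>))"
      unfolding volterra_def using \<Phi>h[OF h(1)] \<Phi>b[OF h(2)] fin
      by (intro weighted_sum_set_integral bounded_set_integrable_lborel[where R="R * K"]) auto
    then show ?thesis
      by (simp add: volterra_def Hk_def weighted_sum_linear[OF matrix_vector_mul_linear])
  qed
  have lim_h: "AE \<tau> in lborel. \<tau> \<in> {t0..s} \<longrightarrow> (\<lambda>k. \<Phi> (s, \<tau>) *v Hk k \<tau>) \<longlonglongrightarrow> \<Phi> (s, \<tau>) *v H \<tau>"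
    if "s \<in> {t0..T}" for s
    using H(2)
  proof eventually_elim
    case (elim \<tau>)
    show ?case
    proof
      assume "\<tau> \<in> {t0..s}"
      then have "(\<lambda>k. Hk k \<tau>) \<longlonglongrightarrow> H \<tau>" using elim that by (simp add: Hk_def)
      then show "(\<lambda>k. \<Phi> (s, \<tau>) *v Hk k \<tau>) \<longlonglongrightarrow> \<Phi> (s, \<tau>) *v H \<tau>"
        by (intro bounded_bilinear.tendsto[OF bounded_bilinear_matrix_vector_mult] tendsto_const)
    qed
  qed
  note vconv = set_integral_tendsto_bounded[OF _ fin \<Phi>h[OF Hk(1)] \<Phi>b[OF Hk(2)] \<Phi>h[OF H(1)] lim_h]
  have vlim: "(\<lambda>k. volterra \<Phi> t0 (Hk k) s) \<longlonglongrightarrow> volterra \<Phi> t0 H s" if "s \<in> {t0..T}" for s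
    unfolding volterra_def by (rule vconv(2)[OF _ that]) simp
  show "set_integrable lborel {t0..t} (\<lambda>\<tau>. \<Phi> (t, \<tau>) *v H \<tau>)"
    by (rule vconv(1)[OF _ t]) simp
  have vb: "norm (volterra \<Phi> t0 (Hk k) s) \<le> R * K" "norm (volterra \<Phi> t0 (h k) s) \<le> R * K" for k s
    using \<Phi>(2,3) Hk(2) h(2) by (simp_all add: norm_volterra_le)
  have gk: "(\<lambda>s. Pk k s + volterra \<Phi> t0 (Hk k) s) \<in> borel_measurable borel"
    "norm (Pk k s + volterra \<Phi> t0 (Hk k) s) \<le> K + R * K" for k s
    using Pk(1)[of k] borel_measurable_volterra[OF \<Phi>(1) Hk(1)[of k]]
      norm_triangle_mono[OF Pk(2) vb(1)]
    by auto
  have gm: "(\<lambda>s. P s + volterra \<Phi> t0 H s) \<in> borel_measurable borel"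
    using P(1) borel_measurable_volterra[OF \<Phi>(1) H(1)] by measurable
  have gl: "AE s in lborel. s \<in> {t0..t} \<longrightarrow>
      (\<lambda>k. Pk k s + volterra \<Phi> t0 (Hk k) s) \<longlonglongrightarrow> P s + volterra \<Phi> t0 H s"
    using P(2)
  proof eventually_elim
    case (elim s)
    then show ?case using t vlim[of s] by (auto simp: Pk_def intro!: tendsto_add)
  qed
  note conv = set_integral_tendsto_bounded[OF _ fin gk(1) gk(2) gm gl]
  show "set_integrable lborel {t0..t} (\<lambda>s. P s + volterra \<Phi> t0 H s)"
    by (rule conv(1)) simp
  have int: "set_integrable lborel {t0..t} (\<lambda>s. p j s + volterra \<Phi> t0 (h j) s)" for j
    using p(1)[of j] borel_measurable_volterra[OF \<Phi>(1) h(1)[of j]] fin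
      norm_triangle_mono[OF p(2) vb(2)]
    by (intro bounded_set_integrable_lborel[where R="K + R * K"]) auto
  have "weighted_sum (c k) (\<lambda>j. x j t) = x0 + (LINT s:{t0..t}|lborel. Pk k s + volterra \<Phi> t0 (Hk k) s)" for k
  proof -
    have "weighted_sum (c k) (\<lambda>j. x j t) =
        weighted_sum (c k) (\<lambda>j. x0 + (LINT s:{t0..t}|lborel. p j s + volterra \<Phi> t0 (h j) s))"
      using x[OF t] by simp
    also have "\<dots> = x0 + (LINT s:{t0..t}|lborel. weighted_sum (c k) (\<lambda>j. p j s + volterra \<Phi> t0 (h j) s))"
      by (simp only: weighted_sum_add weighted_sum_const[OF c] weighted_sum_set_integral[OF int])
    finally show ?thesis by (simp add: weighted_sum_add vs Pk_def)
  qed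
  moreover have "(\<lambda>k. weighted_sum (c k) (\<lambda>j. x j t)) \<longlonglongrightarrow> X t"
    by (rule weighted_sums_tendsto[OF c lim[OF t]])
  moreover have "(\<lambda>k. x0 + (LINT s:{t0..t}|lborel. Pk k s + volterra \<Phi> t0 (Hk k) s)) \<longlonglongrightarrow>
      x0 + (LINT s:{t0..t}|lborel. P s + volterra \<Phi> t0 H s)"
    by (intro tendsto_add tendsto_const conv(2)) simp
  ultimately show "X t = x0 + (LINT s:{t0..t}|lborel. P s + volterra \<Phi> t0 H s)"
    by (simp add: LIMSEQ_unique)
qed

text \<open>The product of a strongly and a weakly convergent sequence, with weak convergence replaced by
  convergence of convex combinations: \<open>(B j - \<beta>) v j\<close> tends to zero because \<open>v\<close> is bounded, and
  \<open>\<beta>\<close> commutes with the combinations.\<close>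

lemma weighted_sum_affine_tendsto:
  fixes A :: "nat \<Rightarrow> real^'n" and B :: "nat \<Rightarrow> real^'m^'n" and v :: "nat \<Rightarrow> real^'m"
  assumes c: "\<And>k. tail_weights k (c k)"
    and A: "A \<longlonglongrightarrow> \<alpha>" and B: "B \<longlonglongrightarrow> \<beta>" and v: "\<And>j. norm (v j) \<le> R"
    and w: "(\<lambda>k. weighted_sum (c k) v) \<longlonglongrightarrow> w"
  shows "(\<lambda>k. weighted_sum (c k) (\<lambda>j. A j + B j *v v j)) \<longlonglongrightarrow> \<alpha> + \<beta> *v w"
proof -
  have "(\<lambda>j. (B j - \<beta>) *v v j) \<longlonglongrightarrow> 0"
  proof (rule Lim_null_comparison)
    show "\<forall>\<^sub>F j in sequentially. norm ((B j - \<beta>) *v v j) \<le> norm (B j - \<beta>) * R"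
      using norm_matrix_vector_mult_le order_trans mult_left_mono[OF v norm_ge_zero]
      by (intro always_eventually allI) blast
    have "(\<lambda>j. norm (B j - \<beta>) * R) \<longlonglongrightarrow> norm (\<beta> - \<beta>) * R"
      by (intro tendsto_intros B)
    then show "(\<lambda>j. norm (B j - \<beta>) * R) \<longlonglongrightarrow> 0" by simp
  qed
  then have "(\<lambda>j. A j + (B j - \<beta>) *v v j) \<longlonglongrightarrow> \<alpha> + 0"
    by (intro tendsto_add A)
  then have "(\<lambda>k. weighted_sum (c k) (\<lambda>j. A j + (B j - \<beta>) *v v j)) \<longlonglongrightarrow> \<alpha> + 0"
    by (rule weighted_sums_tendsto[OF c])
  moreover have "(\<lambda>k. \<beta> *v weighted_sum (c k) v) \<longlonglongrightarrow> \<beta> *v w"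
    by (intro bounded_bilinear.tendsto[OF bounded_bilinear_matrix_vector_mult] tendsto_const w)
  ultimately have "(\<lambda>k. weighted_sum (c k) (\<lambda>j. A j + (B j - \<beta>) *v v j) + \<beta> *v weighted_sum (c k) v) \<longlonglongrightarrow> \<alpha> + 0 + \<beta> *v w"
    by (rule tendsto_add)
  moreover have "weighted_sum (c k) (\<lambda>j. A j + (B j - \<beta>) *v v j) + \<beta> *v weighted_sum (c k) v =
      weighted_sum (c k) (\<lambda>j. A j + B j *v v j)" for k
    unfolding weighted_sum_linear[OF matrix_vector_mul_linear, symmetric] weighted_sum_add[symmetric]
    by (simp add: matrix_vector_mult_diff_rdistrib)
  ultimately show ?thesis by simp
qed

text \<open>The approximations \<open>z j\<close> solve an equation in which the state on the right is \<open>y j\<close>, the delayed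
  \<open>z j\<close>. The Lipschitz bound makes the delay invisible in the limit, so \<open>y j\<close> and \<open>z j\<close> have the
  same limit.\<close>

lemma delayed_approximations_subconverge:
  fixes A A' :: "nat \<Rightarrow> real \<times> (real^'n) \<Rightarrow> real^'n" and B B' :: "nat \<Rightarrow> real \<times> (real^'n) \<Rightarrow> real^'m^'n"
    and V :: "nat \<Rightarrow> real \<times> (real^'n) \<Rightarrow> real^'m" and x0 :: "real^'n"
  assumes meas: "\<And>k. A k \<in> borel_measurable borel" "\<And>k. A' k \<in> borel_measurable borel"
      "\<And>k. B k \<in> borel_measurable borel" "\<And>k. B' k \<in> borel_measurable borel" "\<And>k. V k \<in> borel_measurable borel"
    and bound: "\<And>k z. norm (A k z) \<le> R" "\<And>k z. norm (A' k z) \<le> R" "\<And>k z. norm (B k z) \<le> R"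
      "\<And>k z. norm (B' k z) \<le> R" "\<And>k z. norm (V k z) \<le> R"
    and \<Phi>: "\<Phi> \<in> borel_measurable borel" "\<And>z. norm (\<Phi> z) \<le> R" "\<And>s \<tau>. t0 + 1 < s \<Longrightarrow> \<Phi> (s, \<tau>) = 0"
  obtains x y z \<kappa> where "strict_mono (\<kappa> :: nat \<Rightarrow> nat)" "\<And>j. y j \<in> borel_measurable borel"
    "\<And>t. t \<in> {t0..t0+1} \<Longrightarrow> (\<lambda>j. y j t) \<longlonglongrightarrow> x t" "\<And>t. t \<in> {t0..t0+1} \<Longrightarrow> (\<lambda>j. z j t) \<longlonglongrightarrow> x t"
    "x t0 = x0" "\<And>s t. s \<in> {t0..t0+1} \<Longrightarrow> t \<in> {t0..t0+1} \<Longrightarrow>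
        norm (x t - x s) \<le> ((R + R * R) + R * (R + R * R)) * \<bar>t - s\<bar>"
    "\<And>j t. t \<in> {t0..t0+1} \<Longrightarrow> z j t = x0 + (LINT s:{t0..t}|lborel.
       (A (\<kappa> j) (s, y j s) + B (\<kappa> j) (s, y j s) *v V (\<kappa> j) (s, y j s)) +
       volterra \<Phi> t0 (\<lambda>\<tau>. A' (\<kappa> j) (\<tau>, y j \<tau>) + B' (\<kappa> j) (\<tau>, y j \<tau>) *v V (\<kappa> j) (\<tau>, y j \<tau>)) s)"
proof -
  define K where "K = R + R * R"
  \<comment> \<open>\<open>K\<close> bounds both affine expressions, and \<open>L\<close> bounds the whole right-hand side.\<close>
  define L where "L = K + R * K"
  define p where "p k y s = A k (s, y s) + B k (s, y s) *v V k (s, y s)" for k y s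
  define h where "h k y s = A' k (s, y s) + B' k (s, y s) *v V k (s, y s)" for k y s
  define G where "G k y s = p k y s + volterra \<Phi> t0 (h k y) s" for k y s
  define d where "d k = inverse (real (Suc k))" for k
  have R0: "0 \<le> R" using order_trans[OF norm_ge_zero \<Phi>(2)] .
  then have L0: "0 \<le> L" by (simp add: L_def K_def)
  have prod: "norm (M *v v) \<le> R * R" if "norm M \<le> R" "norm v \<le> R" for M :: "real^'m^'n" and v
    using norm_matrix_vector_mult_le[of M v] mult_mono[OF that] R0 by simp
  have pm: "p k y \<in> borel_measurable borel" and hm: "h k y \<in> borel_measurable borel"
    if "y \<in> borel_measurable borel" for k y
    by (auto simp: p_def[abs_def] h_def[abs_def] intro!: borel_measurable_add
        borel_measurable_matrix_vector_mult borel_measurable_along_curve meas that)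
  have pb: "norm (p k y s) \<le> K" and hb: "norm (h k y s) \<le> K" for k y s
    by (auto simp: p_def h_def K_def intro!: norm_triangle_mono prod bound)
  have ex: "\<exists>x. (\<forall>t\<le>t0. x t = x0) \<and> (\<forall>s t. norm (x t - x s) \<le> L * \<bar>t - s\<bar>) \<and>
      (\<forall>t\<le>t0+1. x t = x0 + (LINT s:{t0..t}|lborel. G k (\<lambda>\<tau>. x (\<tau> - d k)) s))" for k
  proof (rule delayed_integral_equation_solution[of "d k" "G k" L t0 x0 "t0 + 1"])
    show "0 < d k" by (simp add: d_def)
    show "G k y s = G k z s" if "\<And>\<tau>. \<tau> \<le> s \<Longrightarrow> y \<tau> = z \<tau>" for y z s
    proof -
      have "volterra \<Phi> t0 (h k y) s = volterra \<Phi> t0 (h k z) s"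
        unfolding volterra_def by (rule set_lebesgue_integral_cong) (auto simp: h_def that)
      then show ?thesis by (simp add: G_def p_def that)
    qed
    show "G k y \<in> borel_measurable borel" if "y \<in> borel_measurable borel" for y
      unfolding G_def[abs_def] by (intro borel_measurable_add pm borel_measurable_volterra \<Phi>(1) hm that)
    show "norm (G k y s) \<le> L" for y s
      unfolding G_def L_def by (intro norm_triangle_mono pb norm_volterra_le \<Phi> hb)
  qed blast
  have "\<exists>x. \<forall>k. (\<forall>t\<le>t0. x k t = x0) \<and> (\<forall>s t. norm (x k t - x k s) \<le> L * \<bar>t - s\<bar>) \<and>
      (\<forall>t\<le>t0+1. x k t = x0 + (LINT s:{t0..t}|lborel. G k (\<lambda>\<tau>. x k (\<tau> - d k)) s))"
    by (intro choice allI ex)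
  then obtain x where x0: "\<And>k t. t \<le> t0 \<Longrightarrow> x k t = x0"
    and lip: "\<And>k s t. norm (x k t - x k s) \<le> L * \<bar>t - s\<bar>"
    and eq: "\<And>k t. t \<le> t0+1 \<Longrightarrow> x k t = x0 + (LINT s:{t0..t}|lborel. G k (\<lambda>\<tau>. x k (\<tau> - d k)) s)"
    by blast
  have xb: "x k \<in> borel_measurable borel" for k
  proof -
    have "L-lipschitz_on UNIV (x k)" using L0 lip by (auto intro!: lipschitz_onI simp: dist_norm)
    then show ?thesis by (intro borel_measurable_continuous_onI lipschitz_on_continuous_on)
  qed
  have "\<exists>g \<kappa>. strict_mono (\<kappa> :: nat \<Rightarrow> nat) \<and>
      (\<forall>e>0. \<exists>N. \<forall>n t. N \<le> n \<and> t \<in> {t0..t0+1} \<longrightarrow> norm (x (\<kappa> n) t - g t) < e)"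
  proof (rule Arzela_Ascoli[of "{t0..t0+1}" x "norm x0 + L"])
    show "norm (x k t) \<le> norm x0 + L" if "t \<in> {t0..t0+1}" for k t
    proof -
      have "norm (x k t - x k t0) \<le> L * 1"
        using lip[of k t t0] that L0 mult_left_mono[of "\<bar>t - t0\<bar>" 1 L] by auto
      then show ?thesis using norm_triangle_sub[of "x k t" x0] x0[of t0 k] by simp
    qed
    fix t e :: real assume "0 < e"
    show "\<exists>d>0. \<forall>k s. s \<in> {t0..t0+1} \<and> norm (t - s) < d \<longrightarrow> norm (x k t - x k s) < e"
    proof (intro exI conjI allI impI)
      show "0 < e / (L + 1)" using \<open>0 < e\<close> L0 by simp
      fix k s assume "s \<in> {t0..t0+1} \<and> norm (t - s) < e / (L + 1)"
      then have "(L + 1) * \<bar>t - s\<bar> < e" using L0 by (simp add: field_simps)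
      moreover have "L * \<bar>t - s\<bar> \<le> (L + 1) * \<bar>t - s\<bar>" by (simp add: mult_right_mono)
      ultimately show "norm (x k t - x k s) < e" using lip[of k t s] by simp
    qed
  qed (auto intro: that)
  then obtain g \<kappa> where \<kappa>: "strict_mono (\<kappa> :: nat \<Rightarrow> nat)"
    and unif: "\<And>e. 0 < e \<Longrightarrow> \<exists>N. \<forall>n t. N \<le> n \<and> t \<in> {t0..t0+1} \<longrightarrow> norm (x (\<kappa> n) t - g t) < e"
    by blast
  have lim: "(\<lambda>j. x (\<kappa> j) t) \<longlonglongrightarrow> g t" if "t \<in> {t0..t0+1}" for t
    using unif that by (intro LIMSEQ_I) blast
  have dlim: "(\<lambda>j. d (\<kappa> j)) \<longlonglongrightarrow> 0"
    using LIMSEQ_subseq_LIMSEQ[OF LIMSEQ_inverse_real_of_nat \<kappa>] by (simp add: d_def o_def)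
  show thesis
  proof (rule that[of \<kappa> "\<lambda>j t. x (\<kappa> j) (t - d (\<kappa> j))" g "\<lambda>j. x (\<kappa> j)"])
    show "strict_mono \<kappa>" by fact
    show "(\<lambda>t. x (\<kappa> j) (t - d (\<kappa> j))) \<in> borel_measurable borel" for j
      using xb[of "\<kappa> j"] by measurable
    fix t assume t: "t \<in> {t0..t0+1}"
    show "(\<lambda>j. x (\<kappa> j) t) \<longlonglongrightarrow> g t" by (rule lim[OF t])
    have "(\<lambda>j. x (\<kappa> j) (t - d (\<kappa> j)) - x (\<kappa> j) t) \<longlonglongrightarrow> 0"
    proof (rule Lim_null_comparison)
      show "\<forall>\<^sub>F j in sequentially. norm (x (\<kappa> j) (t - d (\<kappa> j)) - x (\<kappa> j) t) \<le> L * d (\<kappa> j)"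
        using lip[of "\<kappa> _" "t - d (\<kappa> _)" t] by (intro always_eventually allI) (simp add: d_def)
      show "(\<lambda>j. L * d (\<kappa> j)) \<longlonglongrightarrow> 0" by (rule tendsto_mult_right_zero[OF dlim])
    qed
    then have "(\<lambda>j. (x (\<kappa> j) (t - d (\<kappa> j)) - x (\<kappa> j) t) + x (\<kappa> j) t) \<longlonglongrightarrow> 0 + g t"
      by (intro tendsto_add lim[OF t])
    then show "(\<lambda>j. x (\<kappa> j) (t - d (\<kappa> j))) \<longlonglongrightarrow> g t" by simp
    show "norm (g t - g s) \<le> (R + R * R + R * (R + R * R)) * \<bar>t - s\<bar>" if "s \<in> {t0..t0+1}" for s
    proof (rule LIMSEQ_le_const2)
      show "(\<lambda>j. norm (x (\<kappa> j) t - x (\<kappa> j) s)) \<longlonglongrightarrow> norm (g t - g s)"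
        by (intro tendsto_intros lim t that)
      show "\<exists>N. \<forall>n\<ge>N. norm (x (\<kappa> n) t - x (\<kappa> n) s) \<le> (R + R * R + R * (R + R * R)) * \<bar>t - s\<bar>"
        using lip by (auto simp: L_def K_def)
    qed
    show "x (\<kappa> j) t = x0 + (LINT s:{t0..t}|lborel.
       (A (\<kappa> j) (s, x (\<kappa> j) (s - d (\<kappa> j))) + B (\<kappa> j) (s, x (\<kappa> j) (s - d (\<kappa> j))) *v V (\<kappa> j) (s, x (\<kappa> j) (s - d (\<kappa> j)))) +
       volterra \<Phi> t0 (\<lambda>\<tau>. A' (\<kappa> j) (\<tau>, x (\<kappa> j) (\<tau> - d (\<kappa> j))) + B' (\<kappa> j) (\<tau>, x (\<kappa> j) (\<tau> - d (\<kappa> j))) *v V (\<kappa> j) (\<tau>, x (\<kappa> j) (\<tau> - d (\<kappa> j)))) s)" for j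
      using eq[of t "\<kappa> j"] t by (simp add: G_def p_def h_def[abs_def])
  next
    have "(\<lambda>j. x (\<kappa> j) t0) \<longlonglongrightarrow> g t0" by (rule lim) simp
    then show "g t0 = x0" by (simp add: x0 LIMSEQ_const_iff)
  qed
qed

section \<open>Filippov regularizations\<close>

text \<open>Near \<open>x\<close> the values \<open>a (t, y) + b (t, y) u (t, y)\<close> differ little from the image of \<open>u (t, y)\<close>
  under the affine map frozen at \<open>x\<close>, uniformly in \<open>y\<close>, because the sections of \<open>u\<close> are essentially
  bounded; the states where the bound fails form a null set that may be discarded. Points whose image
  under the frozen map is close to the convex hull of the values form a convex set, so the estimate
  extends from the values of \<open>u\<close> to their convex hull.\<close>

lemma filippov_reg_affine:
  fixes a :: "real \<times> 'a::euclidean_space \<Rightarrow> real^'n" and b :: "real \<times> 'a \<Rightarrow> real^'m^'n"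
    and u :: "real \<times> 'a \<Rightarrow> real^'m"
  assumes a: "continuous (at x) (\<lambda>y. a (t, y))" and b: "continuous (at x) (\<lambda>y. b (t, y))"
    and u: "AE y in lborel. y \<in> ball x \<rho> \<longrightarrow> norm (u (t, y)) \<le> R" "0 < \<rho>"
    and v: "v \<in> filippov_reg u t x"
  shows "a (t, x) + b (t, x) *v v \<in> filippov_reg (\<lambda>(s, y). a (s, y) + b (s, y) *v u (s, y)) t x"
  unfolding filippov_reg_def
proof (intro INT_I)
  fix \<delta> :: real and M :: "'a set" assume "\<delta> \<in> {0<..}" and M: "M \<in> null_sets lebesgue"
  then have \<delta>: "0 < \<delta>" by simp
  let ?F = "\<lambda>y. a (t, y) + b (t, y) *v u (t, y)"
  let ?H = "convex hull (?F ` (ball x \<delta> - M))"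
  have "a (t, x) + b (t, x) *v v \<in> closure ?H"
    unfolding closure_approachable
  proof (intro allI impI)
    fix e :: real assume "0 < e"
    define Q where "Q = max R 0"
    have Q: "0 \<le> Q" "R \<le> Q" by (simp_all add: Q_def)
    \<comment> \<open>\<open>e1\<close> measures freezing the coefficients at \<open>x\<close>, \<open>e2\<close> approximating \<open>v\<close> by a point of the hull; each costs at most \<open>e / 2\<close>.\<close>
    define e1 where "e1 = e / 2 / (1 + Q)"
    define e2 where "e2 = e / (2 * (norm (b (t, x)) + 1))"
    have e1: "0 < e1" using \<open>0 < e\<close> Q by (simp add: e1_def)
    have e2: "0 < e2" using \<open>0 < e\<close> by (simp add: e2_def add_nonneg_pos)
    obtain d1 where d1: "0 < d1" "\<And>y. dist y x < d1 \<Longrightarrow> dist (a (t, y)) (a (t, x)) < e1"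
      using a[unfolded continuous_at_eps_delta, rule_format, OF e1] by auto
    obtain d2 where d2: "0 < d2" "\<And>y. dist y x < d2 \<Longrightarrow> dist (b (t, y)) (b (t, x)) < e1"
      using b[unfolded continuous_at_eps_delta, rule_format, OF e1] by auto
    define r where "r = min (min d1 d2) (min \<delta> \<rho>)"
    have r: "0 < r" "r \<le> d1" "r \<le> d2" "r \<le> \<delta>" "r \<le> \<rho>"
      using d1(1) d2(1) \<delta> u(2) by (auto simp: r_def)
    define N where "N = {y. \<not> (y \<in> ball x \<rho> \<longrightarrow> norm (u (t, y)) \<le> R)}"
    have "AE y in lebesgue. y \<in> ball x \<rho> \<longrightarrow> norm (u (t, y)) \<le> R"
      using u(1) by (simp add: AE_completion_iff)
    then have "N \<in> null_sets lebesgue"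
      by (simp add: completion.AE_iff_null_sets N_def)
    then have MN: "M \<union> N \<in> null_sets lebesgue" using M by (rule null_sets.Un[rotated])
    have "v \<in> closure (convex hull ((\<lambda>y. u (t, y)) ` (ball x r - (M \<union> N))))"
      using v r(1) MN unfolding filippov_reg_def by blast
    then obtain v' where v': "v' \<in> convex hull ((\<lambda>y. u (t, y)) ` (ball x r - (M \<union> N)))" "dist v' v < e2"
      using e2 unfolding closure_approachable by blast
    define S where "S = {w. \<exists>z\<in>?H. norm (z - (a (t, x) + b (t, x) *v w)) \<le> e1 * (1 + Q)}"
    have "convex S"
    proof (rule convexI)
      fix w1 w2 and c1 c2 :: real assume w: "w1 \<in> S" "w2 \<in> S" and c: "0 \<le> c1" "0 \<le> c2" "c1 + c2 = 1"
      obtain z1 z2 where z: "z1 \<in> ?H" "norm (z1 - (a (t, x) + b (t, x) *v w1)) \<le> e1 * (1 + Q)"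
        "z2 \<in> ?H" "norm (z2 - (a (t, x) + b (t, x) *v w2)) \<le> e1 * (1 + Q)"
        using w by (auto simp: S_def)
      let ?g = "\<lambda>w. a (t, x) + b (t, x) *v w"
      have ca: "a (t, x) = c1 *\<^sub>R a (t, x) + c2 *\<^sub>R a (t, x)"
        using c(3) by (simp add: scaleR_left_distrib[symmetric])
      have "(c1 *\<^sub>R z1 + c2 *\<^sub>R z2) - ?g (c1 *\<^sub>R w1 + c2 *\<^sub>R w2) = c1 *\<^sub>R (z1 - ?g w1) + c2 *\<^sub>R (z2 - ?g w2)"
        by (subst ca) (simp add: algebra_simps matrix_vector_mult_scaleR matrix_vector_right_distrib)
      also have "norm \<dots> \<le> c1 * norm (z1 - ?g w1) + c2 * norm (z2 - ?g w2)"
        using norm_triangle_ineq[of "c1 *\<^sub>R (z1 - ?g w1)" "c2 *\<^sub>R (z2 - ?g w2)"] c by simp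
      also have "\<dots> \<le> e1 * (1 + Q)"
        by (rule convex_bound_le[OF z(2,4) c])
      finally show "c1 *\<^sub>R w1 + c2 *\<^sub>R w2 \<in> S"
        unfolding S_def using convexD[OF convex_convex_hull z(1,3) c] by blast
    qed
    moreover have "(\<lambda>y. u (t, y)) ` (ball x r - (M \<union> N)) \<subseteq> S"
    proof (rule image_subsetI)
      fix y assume "y \<in> ball x r - (M \<union> N)"
      then have y: "y \<in> ball x r" "y \<notin> M" "y \<notin> N" by auto
      have dy: "dist y x < d1" "dist y x < d2" "y \<in> ball x \<delta>" "y \<in> ball x \<rho>"
        using y(1) r by (auto simp: dist_commute)
      have un: "norm (u (t, y)) \<le> Q" using y(3) dy(4) Q(2) by (simp add: N_def)
      have "?F y - (a (t, x) + b (t, x) *v u (t, y)) = (a (t, y) - a (t, x)) + (b (t, y) - b (t, x)) *v u (t, y)"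
        by (simp add: algebra_simps matrix_vector_mult_diff_rdistrib)
      also have "norm \<dots> \<le> e1 + e1 * Q"
      proof (rule norm_triangle_mono)
        show "norm (a (t, y) - a (t, x)) \<le> e1" using d1(2)[OF dy(1)] by (simp add: dist_norm)
        have "norm (b (t, y) - b (t, x)) \<le> e1" using d2(2)[OF dy(2)] by (simp add: dist_norm)
        then show "norm ((b (t, y) - b (t, x)) *v u (t, y)) \<le> e1 * Q"
          using norm_matrix_vector_mult_le[of "b (t, y) - b (t, x)" "u (t, y)"] e1
            mult_mono[of "norm (b (t, y) - b (t, x))" e1 "norm (u (t, y))" Q] un by simp
      qed
      finally have "norm (?F y - (a (t, x) + b (t, x) *v u (t, y))) \<le> e1 * (1 + Q)"
        by (simp add: distrib_left)
      moreover have "?F y \<in> ?H" using y(2) dy(3) by (intro hull_inc) auto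
      ultimately show "u (t, y) \<in> S" unfolding S_def by blast
    qed
    ultimately have "v' \<in> S" using v'(1) hull_minimal[of _ S convex] by blast
    then obtain z where z: "z \<in> ?H" "norm (z - (a (t, x) + b (t, x) *v v')) \<le> e1 * (1 + Q)"
      by (auto simp: S_def)
    have "z - (a (t, x) + b (t, x) *v v) = (z - (a (t, x) + b (t, x) *v v')) + b (t, x) *v (v' - v)"
      by (simp add: matrix_vector_mult_diff_distrib)
    then have "dist z (a (t, x) + b (t, x) *v v) \<le> norm (z - (a (t, x) + b (t, x) *v v')) + norm (b (t, x) *v (v' - v))"
      by (metis dist_norm norm_triangle_ineq)
    also have "\<dots> < e / 2 + e / 2"
    proof (rule add_le_less_mono)
      show "norm (z - (a (t, x) + b (t, x) *v v')) \<le> e / 2"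
      proof -
        have "1 + Q \<noteq> 0" using Q by simp
        then have "e1 * (1 + Q) = e / 2" by (metis e1_def nonzero_eq_divide_eq)
        then show ?thesis using z(2) by simp
      qed
      have "norm (b (t, x) *v (v' - v)) \<le> norm (b (t, x)) * norm (v' - v)"
        by (rule norm_matrix_vector_mult_le)
      also have "\<dots> \<le> norm (b (t, x)) * e2"
        using v'(2) by (intro mult_left_mono) (auto simp: dist_norm)
      also have "\<dots> < (norm (b (t, x)) + 1) * e2" using e2 by simp
      also have "\<dots> = e / 2" by (simp add: e2_def add_nonneg_pos field_simps add_nonneg_eq_0_iff)
      finally show "norm (b (t, x) *v (v' - v)) < e / 2" .
    qed
    finally show "\<exists>z\<in>?H. dist z (a (t, x) + b (t, x) *v v) < e" using z(1) by auto
  qed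
  then show "a (t, x) + b (t, x) *v v \<in>
      closure (convex hull ((\<lambda>y. case (t, y) of (s, y) \<Rightarrow> a (s, y) + b (s, y) *v u (s, y)) ` (ball x \<delta> - M)))"
    by simp
qed

lemma filippov_reg_component:
  fixes u :: "real \<times> 'a::euclidean_space \<Rightarrow> real^'m"
  assumes "v \<in> filippov_reg u t x"
  shows "v $ i \<in> filippov_reg (\<lambda>p. u p $ i) t x"
  unfolding filippov_reg_def
proof (intro INT_I)
  fix \<delta> :: real and M :: "'a set" assume *: "\<delta> \<in> {0<..}" "M \<in> null_sets lebesgue"
  let ?X = "(\<lambda>y. u (t, y)) ` (ball x \<delta> - M)" and ?f = "\<lambda>v::real^'m. v $ i"
  have f: "bounded_linear ?f" by (rule bounded_linear_vec_nth)
  have "v \<in> closure (convex hull ?X)" using assms * unfolding filippov_reg_def by blast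
  then have "v $ i \<in> closure (?f ` (convex hull ?X))"
    using closure_bounded_linear_image_subset[OF f] by blast
  also have "?f ` (convex hull ?X) = convex hull (?f ` ?X)"
    using convex_hull_linear_image[of ?f ?X] f bounded_linear.linear by blast
  finally show "v $ i \<in> closure (convex hull ((\<lambda>y. u (t, y) $ i) ` (ball x \<delta> - M)))"
    by (simp add: image_image)
qed

text \<open>For large \<open>j\<close> the balls lie in \<open>ball x \<delta>\<close>, and the averages do not see the null set \<open>M\<close>; so they
  lie in each of the closed convex sets whose intersection is the regularization, and so do
  combinations of their tails and the limits of these.\<close>

lemma limit_of_averages_in_filippov_reg:
  fixes u :: "real \<times> 'a::euclidean_space \<Rightarrow> 'b::euclidean_space"
  assumes g: "g \<in> borel_measurable borel" "\<And>y. norm (g y) \<le> R"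
    and gu: "AE y in lborel. y \<in> ball x \<rho> \<longrightarrow> g y = u (t, y)" "0 < \<rho>"
    and r: "\<And>j. 0 < r j" "r \<longlonglongrightarrow> 0" and y: "y \<longlonglongrightarrow> x"
    and c: "\<And>k. tail_weights k (c k)"
    and w: "(\<lambda>k. weighted_sum (c k) (\<lambda>j. ball_average g (r j) (y j))) \<longlonglongrightarrow> w"
  shows "w \<in> filippov_reg u t x"
  unfolding filippov_reg_def
proof (intro INT_I)
  fix \<delta> :: real and M :: "'a set" assume "\<delta> \<in> {0<..}" and M: "M \<in> null_sets lebesgue"
  then have \<delta>: "0 < \<delta>" by simp
  let ?S = "closure (convex hull ((\<lambda>y. u (t, y)) ` (ball x \<delta> - M)))"
  have S: "convex ?S" "closed ?S" by (simp_all add: convex_closure)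
  have pos: "0 < min \<delta> \<rho> / 2" using \<delta> gu(2) by simp
  have "\<forall>\<^sub>F j in sequentially. ball_average g (r j) (y j) \<in> ?S"
    using tendstoD[OF y pos] tendstoD[OF r(2) pos]
  proof eventually_elim
    case (elim j)
    have sub: "dist z x < min \<delta> \<rho>" if "z \<in> ball (y j) (r j)" for z
      using elim that dist_triangle[of z x "y j"] r(1)[of j] by (auto simp: dist_commute)
    have "AE z in lborel. z \<notin> M"
      using AE_not_in[OF M] by (simp add: AE_completion_iff)
    with gu(1) have "AE z in lborel. z \<in> ball (y j) (r j) \<longrightarrow> g z \<in> ?S"
    proof eventually_elim
      case (elim z)
      show ?case
      proof
        assume z: "z \<in> ball (y j) (r j)"
        have "z \<in> ball x \<rho>" "z \<in> ball x \<delta> - M" using sub[OF z] elim by (auto simp: dist_commute)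
        then have "g z \<in> (\<lambda>y. u (t, y)) ` (ball x \<delta> - M)" using elim by auto
        then show "g z \<in> ?S" by (intro subsetD[OF closure_subset] hull_inc)
      qed
    qed
    then show ?case by (rule ball_average_in_closed_convex[OF g r(1) S])
  qed
  then obtain N where N: "\<And>j. N \<le> j \<Longrightarrow> ball_average g (r j) (y j) \<in> ?S"
    by (auto simp: eventually_sequentially)
  have "weighted_sum (c k) (\<lambda>j. ball_average g (r j) (y j)) \<in> ?S" if "N \<le> k" for k
    using that N by (intro weighted_sum_in_convex[OF c S(1)]) auto
  then show "w \<in> ?S"
    by (intro Lim_in_closed_set[OF S(2) _ _ w]) (auto simp: eventually_sequentially)
qed

section \<open>Utkin solutions are Filippov solutions\<close>

text \<open>Local essential boundedness concerns the joint variable. Fubini's theorem transfers the bound on each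
  of countably many balls to almost every section; the bound depends on the section.\<close>

lemma AE_locally_bounded_sections:
  fixes u :: "real \<times> 'a::euclidean_space \<Rightarrow> 'b::real_normed_vector"
  assumes "locally_essentially_bounded_on UNIV u"
  shows "AE t in lborel. \<forall>x. \<exists>R. AE y in lborel. y \<in> ball x 1 \<longrightarrow> norm (u (t, y)) \<le> R"
proof -
  have "AE t in lborel. \<exists>R. AE y in lborel. (t, y) \<in> cball 0 (real n) \<longrightarrow> norm (u (t, y)) \<le> R" for n
  proof -
    obtain R where "AE z in lborel. z \<in> cball 0 (real n) \<longrightarrow> norm (u z) \<le> R"
      using locally_essentially_bounded_onD[OF assms, of "cball 0 (real n)"] by auto
    from AE_lborel_slices[OF this] show ?thesis by eventually_elim blast
  qed
  then have "AE t in lborel. \<forall>n. \<exists>R. AE y in lborel. (t, y) \<in> cball 0 (real n) \<longrightarrow> norm (u (t, y)) \<le> R"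
    by (simp add: AE_all_countable)
  then show ?thesis
  proof eventually_elim
    case (elim t)
    show ?case
    proof
      fix x :: 'a
      obtain n :: nat where n: "norm t + norm x + 1 \<le> real n" using real_arch_simple by blast
      obtain R where R: "AE y in lborel. (t, y) \<in> cball 0 (real n) \<longrightarrow> norm (u (t, y)) \<le> R"
        using elim by blast
      have sub: "(t, y) \<in> cball 0 (real n)" if "y \<in> ball x 1" for y
      proof -
        have "norm y \<le> norm x + 1"
          using that norm_triangle_ineq[of x "y - x"] by (simp add: dist_norm norm_minus_commute)
        then show ?thesis using n norm_Pair_le[of t y] by simp
      qed
      have "AE y in lborel. y \<in> ball x 1 \<longrightarrow> norm (u (t, y)) \<le> R"
        using R by eventually_elim (use sub in blast)
      then show "\<exists>R. AE y in lborel. y \<in> ball x 1 \<longrightarrow> norm (u (t, y)) \<le> R" by blast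
    qed
  qed
qed

text \<open>One null set of times serves for all states and all controls, so the inclusion may be used along an
  arbitrary trajectory.\<close>

lemma filippov_selection_ae:
  fixes a :: "real \<times> (real^'n) \<Rightarrow> real^'n" and b :: "real \<times> (real^'n) \<Rightarrow> real^'m^'n"
    and u :: "real \<times> (real^'n) \<Rightarrow> real^'m"
  assumes "\<And>t. continuous_on UNIV (\<lambda>x. a (t, x))" "\<And>t. continuous_on UNIV (\<lambda>x. b (t, x))"
    and "locally_essentially_bounded_on UNIV u"
  shows "AE t in lborel. \<forall>x. \<forall>v\<in>filippov_reg u t x.
    a (t, x) + b (t, x) *v v \<in> filippov_reg (\<lambda>(s, y). a (s, y) + b (s, y) *v u (s, y)) t x"
  using AE_locally_bounded_sections[OF assms(3)]
proof eventually_elim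
  case (elim t)
  show ?case
  proof (intro allI ballI)
    fix x v assume v: "v \<in> filippov_reg u t x"
    obtain R where R: "AE y in lborel. y \<in> ball x 1 \<longrightarrow> norm (u (t, y)) \<le> R" using elim by blast
    show "a (t, x) + b (t, x) *v v \<in> filippov_reg (\<lambda>(s, y). a (s, y) + b (s, y) *v u (s, y)) t x"
      using assms(1,2)[of t] by (intro filippov_reg_affine[OF _ _ R _ v]) (auto simp: continuous_on_eq_continuous_at)
  qed
qed

lemma forward_interval_sets: "forward_interval t0 I \<Longrightarrow> I \<in> sets borel"
  by (auto simp: forward_interval_def)

lemma forward_interval_initial_segment:
  "forward_interval t0 I \<Longrightarrow> t \<in> I \<Longrightarrow> {t0..t} \<subseteq> I"
  by (auto simp: forward_interval_def)

lemma AE_lebesgue_on_iff: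
  "S \<in> sets borel \<Longrightarrow> (AE t in lebesgue_on S. P t) \<longleftrightarrow> (AE t in lborel. t \<in> S \<longrightarrow> P t)"
  by (simp add: AE_restrict_space_iff AE_completion_iff)

text \<open>The set-valued maps enter only through selections, so the equivalent control of the Utkin solution
  serves for the Filippov inclusion at every time, inside the Aumann integral as well.\<close>

theorem utkin_first_imp_filippov:
  fixes a a' :: "real \<times> (real^'n) \<Rightarrow> real^'n" and b b' :: "real \<times> (real^'n) \<Rightarrow> real^'m^'n"
    and u :: "real \<times> (real^'n) \<Rightarrow> real^'m"
  assumes f: "\<And>t x v. f t x v = a (t, x) + b (t, x) *v v"
    and f': "\<And>t x v. f' t x v = a' (t, x) + b' (t, x) *v v"
    and cont: "\<And>t. continuous_on UNIV (\<lambda>x. a (t, x))" "\<And>t. continuous_on UNIV (\<lambda>x. a' (t, x))"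
      "\<And>t. continuous_on UNIV (\<lambda>x. b (t, x))" "\<And>t. continuous_on UNIV (\<lambda>x. b' (t, x))"
    and u: "locally_essentially_bounded_on UNIV u"
    and utkin: "utkin_solution_first u \<Phi> f f' t0 x0 I x"
  shows "filippov_solution u \<Phi> f f' t0 x0 I x"
proof -
  have ac: "ac_trajectory t0 x0 I x" using utkin by (simp add: utkin_solution_first_def utkin_solution_def)
  then have I: "forward_interval t0 I" by (simp add: ac_trajectory_def)
  note Is = forward_interval_sets[OF I]
  obtain ueq where ae: "AE t in lebesgue_on I. ueq t \<in> filippov_reg u t (x t) \<and>
          (\<exists>w. has_bochner_integral (lebesgue_on {t0..t})
                 (\<lambda>\<tau>. \<Phi> (t, \<tau>) *v f' \<tau> (x \<tau>) (ueq \<tau>)) w \<and>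
               (x has_vector_derivative f t (x t) (ueq t) + w) (at t within I))"
    using utkin by (auto simp: utkin_solution_first_def utkin_solution_def)
  let ?K' = "filippov_reg (\<lambda>(s, y). f' s y (u (s, y)))"
  have F: "AE t in lborel. \<forall>x. \<forall>v\<in>filippov_reg u t x. f t x v \<in> filippov_reg (\<lambda>(s, y). f s y (u (s, y))) t x"
    unfolding f by (rule filippov_selection_ae[OF cont(1,3) u])
  have F': "AE t in lborel. \<forall>x. \<forall>v\<in>filippov_reg u t x. f' t x v \<in> ?K' t x"
    unfolding f' by (rule filippov_selection_ae[OF cont(2,4) u])
  have "AE t in lborel. t \<in> I \<longrightarrow> ueq t \<in> filippov_reg u t (x t)"
    using ae Is by (auto simp: AE_lebesgue_on_iff elim: eventually_mono)
  with F' have sel: "AE t in lborel. t \<in> I \<longrightarrow> f' t (x t) (ueq t) \<in> ?K' t (x t)"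
    by eventually_elim blast
  have "AE t in lborel. t \<in> I \<longrightarrow> (\<exists>v. (x has_vector_derivative v) (at t within I) \<and>
            v \<in> filippov_reg (\<lambda>(s, y). f s y (u (s, y))) t (x t) +
                aumann_integral (lebesgue_on {t0..t}) (\<lambda>\<tau>. (\<lambda>y. \<Phi> (t, \<tau>) *v y) ` ?K' \<tau> (x \<tau>)))"
    using F ae[unfolded AE_lebesgue_on_iff[OF Is]]
  proof eventually_elim
    case (elim t)
    show ?case
    proof
      assume t: "t \<in> I"
      then obtain w where w: "has_bochner_integral (lebesgue_on {t0..t}) (\<lambda>\<tau>. \<Phi> (t, \<tau>) *v f' \<tau> (x \<tau>) (ueq \<tau>)) w"
        "(x has_vector_derivative f t (x t) (ueq t) + w) (at t within I)"
        and ut: "ueq t \<in> filippov_reg u t (x t)" using elim by blast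
      have "AE \<tau> in lebesgue_on {t0..t}. f' \<tau> (x \<tau>) (ueq \<tau>) \<in> ?K' \<tau> (x \<tau>)"
        unfolding AE_lebesgue_on_iff[OF atLeastAtMost_borel]
        using sel by eventually_elim (use forward_interval_initial_segment[OF I t] in blast)
      then have "AE \<tau> in lebesgue_on {t0..t}. \<Phi> (t, \<tau>) *v f' \<tau> (x \<tau>) (ueq \<tau>) \<in> (\<lambda>y. \<Phi> (t, \<tau>) *v y) ` ?K' \<tau> (x \<tau>)"
        by eventually_elim blast
      then have "w \<in> aumann_integral (lebesgue_on {t0..t}) (\<lambda>\<tau>. (\<lambda>y. \<Phi> (t, \<tau>) *v y) ` ?K' \<tau> (x \<tau>))"
        using w(1) unfolding aumann_integral_def has_bochner_integral_iff by blast
      moreover have "f t (x t) (ueq t) \<in> filippov_reg (\<lambda>(s, y). f s y (u (s, y))) t (x t)"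
        using elim(1) ut by blast
      ultimately show "\<exists>v. (x has_vector_derivative v) (at t within I) \<and>
            v \<in> filippov_reg (\<lambda>(s, y). f s y (u (s, y))) t (x t) +
                aumann_integral (lebesgue_on {t0..t}) (\<lambda>\<tau>. (\<lambda>y. \<Phi> (t, \<tau>) *v y) ` ?K' \<tau> (x \<tau>))"
        using w(2) by (blast intro: set_plus_intro)
    qed
  qed
  then show ?thesis
    using ac Is by (simp add: filippov_solution_def AE_lebesgue_on_iff)
qed

lemma utkin_first_imp_second:
  assumes "utkin_solution_first u \<Phi> f f' t0 x0 I x"
  shows "utkin_solution_second u \<Phi> f f' t0 x0 I x"
proof -
  obtain ueq where ueq: "ueq \<in> borel_measurable (lebesgue_on I)" and ae: "AE t in lebesgue_on I. ueq t \<in> filippov_reg u t (x t) \<and>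
          (\<exists>w. has_bochner_integral (lebesgue_on {t0..t})
                 (\<lambda>\<tau>. \<Phi> (t, \<tau>) *v f' \<tau> (x \<tau>) (ueq \<tau>)) w \<and>
               (x has_vector_derivative f t (x t) (ueq t) + w) (at t within I))"
    and ac: "ac_trajectory t0 x0 I x"
    using assms by (auto simp: utkin_solution_first_def utkin_solution_def)
  have "AE t in lebesgue_on I. ueq t \<in> {v. \<forall>i. v $ i \<in> filippov_reg (\<lambda>p. u p $ i) t (x t)} \<and>
          (\<exists>w. has_bochner_integral (lebesgue_on {t0..t})
                 (\<lambda>\<tau>. \<Phi> (t, \<tau>) *v f' \<tau> (x \<tau>) (ueq \<tau>)) w \<and>
               (x has_vector_derivative f t (x t) (ueq t) + w) (at t within I))"
    using ae by eventually_elim (auto intro: filippov_reg_component)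
  then show ?thesis
    using ac ueq unfolding utkin_solution_second_def utkin_solution_def by blast
qed

section \<open>Existence of Utkin solutions\<close>

lemma lipschitz_imp_absolutely_continuous_on:
  fixes x :: "real \<Rightarrow> 'a::real_normed_vector"
  assumes lip: "\<And>s t. s \<in> S \<Longrightarrow> t \<in> S \<Longrightarrow> norm (x t - x s) \<le> L * \<bar>t - s\<bar>" and L: "0 \<le> L"
  shows "absolutely_continuous_on S x"
  unfolding absolutely_continuous_on_def
proof (intro allI impI)
  fix \<epsilon> :: real assume "0 < \<epsilon>"
  show "\<exists>\<delta>>0. \<forall>D. D division_of \<Union>D \<and> \<Union>D \<subseteq> S \<and> (\<Sum>k\<in>D. measure lborel k) < \<delta> \<longrightarrow>
      (\<Sum>k\<in>D. norm (x (Sup k) - x (Inf k))) < \<epsilon>"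
  proof (intro exI conjI allI impI)
    show "0 < \<epsilon> / (L + 1)" using \<open>0 < \<epsilon>\<close> L by simp
    fix D :: "real set set" assume D: "D division_of \<Union>D \<and> \<Union>D \<subseteq> S \<and> (\<Sum>k\<in>D. measure lborel k) < \<epsilon> / (L + 1)"
    have "(\<Sum>k\<in>D. norm (x (Sup k) - x (Inf k))) \<le> (\<Sum>k\<in>D. L * measure lborel k)"
    proof (rule sum_mono)
      fix k assume k: "k \<in> D"
      obtain a b where ab: "k = {a..b}" "k \<noteq> {}" "k \<subseteq> S"
        using division_ofD(2-4)[of D "\<Union>D" k] D k by (metis Union_upper box_real(2) order_trans)
      then have "a \<le> b" "a \<in> S" "b \<in> S" by auto
      then show "norm (x (Sup k) - x (Inf k)) \<le> L * measure lborel k"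
        using lip[of a b] by (simp add: ab(1))
    qed
    also have "\<dots> = L * (\<Sum>k\<in>D. measure lborel k)" by (simp add: sum_distrib_left)
    also have "\<dots> \<le> (L + 1) * (\<Sum>k\<in>D. measure lborel k)"
      by (intro mult_right_mono sum_nonneg) auto
    also have "\<dots> < \<epsilon>" using D L by (simp add: pos_less_divide_eq mult.commute)
    finally show "(\<Sum>k\<in>D. norm (x (Sup k) - x (Inf k))) < \<epsilon>" .
  qed
qed

lemma has_bochner_integral_lebesgue_on_AE_eq:
  fixes g h :: "'a::euclidean_space \<Rightarrow> 'b::euclidean_space"
  assumes S: "S \<in> sets borel" and g: "set_integrable lborel S g"
    and gh: "AE s in lborel. s \<in> S \<longrightarrow> g s = h s"
  shows "has_bochner_integral (lebesgue_on S) h (LINT s:S|lborel. g s)"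
proof -
  let ?g = "\<lambda>s. indicat_real S s *\<^sub>R g s" and ?h = "\<lambda>s. indicat_real S s *\<^sub>R h s"
  have int: "integrable lborel ?g" using g by (simp add: set_integrable_def)
  then have gm: "?g \<in> borel_measurable lborel" by (rule borel_measurable_integrable)
  have hb: "has_bochner_integral lebesgue ?g (LINT s:S|lborel. g s)"
    using int gm by (simp add: has_bochner_integral_iff integrable_completion integral_completion set_lebesgue_integral_def)
  have ae: "AE s in lebesgue. ?g s = ?h s"
    unfolding AE_completion_iff using gh by eventually_elim (auto simp: indicator_def)
  have gm': "?g \<in> borel_measurable lebesgue" by (rule measurable_completion[OF gm])
  have "?h \<in> borel_measurable lebesgue" by (rule borel_measurable_AE[OF gm' ae])
  then have "has_bochner_integral lebesgue ?h (LINT s:S|lborel. g s)"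
    using hb has_bochner_integral_cong_AE[OF gm' _ ae] by blast
  then show ?thesis
    using S by (subst has_bochner_integral_restrict_space) auto
qed

text \<open>The representative is only known to be correct on a box around the initial point, and only almost
  everywhere. Since the curve stays in the inner half of the box, the balls of radius \<open>1/2\<close> around
  its points do not leave the box.\<close>

lemma AE_representative_near_curve:
  fixes g g0 :: "real \<times> 'a::euclidean_space \<Rightarrow> 'b"
  assumes ae: "AE z in lborel. z \<in> {t0..t0+1} \<times> cball x0 1 \<longrightarrow> g0 z = g z"
    and J: "J \<subseteq> {t0..t0+1}" "\<forall>t\<in>J. dist x0 (x t) \<le> 1/2"
  shows "AE t in lborel. t \<in> J \<longrightarrow> (AE y in lborel. y \<in> ball (x t) (1/2) \<longrightarrow> g0 (t, y) = g (t, y))"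
  using AE_lborel_slices[OF ae]
proof eventually_elim
  case (elim t)
  show ?case
  proof
    assume t: "t \<in> J"
    have sub: "(t, y) \<in> {t0..t0+1} \<times> cball x0 1" if "y \<in> ball (x t) (1/2)" for y
      using that J(1) bspec[OF J(2) t] t dist_triangle[of x0 y "x t"] by auto
    show "AE y in lborel. y \<in> ball (x t) (1/2) \<longrightarrow> g0 (t, y) = g (t, y)"
      using elim by eventually_elim (use sub in blast)
  qed
qed

text \<open>The limit is the value of the original function at the single point \<open>x t\<close>, not of its
  representative; this is where continuity in the state enters.\<close>

lemma averages_along_curves_tendsto:
  fixes g g0 :: "real \<times> 'a::euclidean_space \<Rightarrow> 'b::euclidean_space"
  assumes g0: "g0 \<in> borel_measurable borel" "\<And>z. norm (g0 z) \<le> R"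
    and ae: "AE z in lborel. z \<in> {t0..t0+1} \<times> cball x0 1 \<longrightarrow> g0 z = g z"
    and cont: "\<And>t. continuous_on UNIV (\<lambda>x. g (t, x))"
    and J: "J \<subseteq> {t0..t0+1}" "\<forall>t\<in>J. dist x0 (x t) \<le> 1/2"
    and r: "\<And>j. 0 < r j" "r \<longlonglongrightarrow> 0" and y: "\<forall>t\<in>J. (\<lambda>j. y j t) \<longlonglongrightarrow> x t"
  shows "AE t in lborel. t \<in> J \<longrightarrow> (\<lambda>j. ball_average (\<lambda>y. g0 (t, y)) (r j) (y j t)) \<longlonglongrightarrow> g (t, x t)"
  using AE_representative_near_curve[OF ae J]
proof eventually_elim
  case (elim t)
  show ?case
  proof
    assume t: "t \<in> J"
    show "(\<lambda>j. ball_average (\<lambda>y. g0 (t, y)) (r j) (y j t)) \<longlonglongrightarrow> g (t, x t)"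
    proof (rule ball_average_tendsto[OF borel_measurable_section[OF g0(1)] g0(2) _ _ _ r bspec[OF y t]])
      show "continuous (at (x t)) (\<lambda>y. g (t, y))"
        using cont[of t] by (simp add: continuous_on_eq_continuous_at)
      show "AE y in lborel. y \<in> ball (x t) (1/2) \<longrightarrow> g0 (t, y) = g (t, y)" using elim t by blast
    qed simp
  qed
qed

theorem utkin_first_exists:
  fixes \<Phi> :: "real \<times> real \<Rightarrow> real^'n^'n"
    and a a' :: "real \<times> (real^'n) \<Rightarrow> real^'n"
    and b b' :: "real \<times> (real^'n) \<Rightarrow> real^'m^'n"
    and u :: "real \<times> (real^'n) \<Rightarrow> real^'m"
  assumes \<Delta>: "\<Delta> = {(t, \<tau>). t \<ge> \<tau>}"
    and \<Phi>: "\<Phi> \<in> borel_measurable (lebesgue_on \<Delta>)" "locally_essentially_bounded_on \<Delta> \<Phi>"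
    and f: "\<And>t x v. f t x v = a (t, x) + b (t, x) *v v"
    and f': "\<And>t x v. f' t x v = a' (t, x) + b' (t, x) *v v"
    and measurable: "a \<in> borel_measurable lebesgue" "a' \<in> borel_measurable lebesgue"
      "b \<in> borel_measurable lebesgue" "b' \<in> borel_measurable lebesgue"
    and bounded: "locally_essentially_bounded_on UNIV a" "locally_essentially_bounded_on UNIV a'"
      "locally_essentially_bounded_on UNIV b" "locally_essentially_bounded_on UNIV b'"
    and continuous: "\<And>t. continuous_on UNIV (\<lambda>x. a (t, x))"
      "\<And>t. continuous_on UNIV (\<lambda>x. a' (t, x))"
      "\<And>t. continuous_on UNIV (\<lambda>x. b (t, x))"
      "\<And>t. continuous_on UNIV (\<lambda>x. b' (t, x))"
    and u: "u \<in> borel_measurable lebesgue" "locally_essentially_bounded_on UNIV u"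
  shows "\<exists>\<alpha>>0. \<exists>x. utkin_solution_first u \<Phi> f f' t0 x0 {t0..<t0 + \<alpha>} x"
proof -
  let ?C = "{t0..t0+1} \<times> cball x0 1"
  have C: "compact ?C" by (intro compact_Times) auto
  let ?D = "{(t, \<tau>). t0 \<le> \<tau> \<and> \<tau> \<le> t \<and> t \<le> t0 + 1}"
  \<comment> \<open>The part of \<open>\<Delta>\<close> that the inner integral meets up to time \<open>t0 + 1\<close>.\<close>
  have D: "compact ?D"
  proof -
    have "?D = ({t0..t0+1} \<times> {t0..t0+1}) \<inter> {z. snd z \<le> fst z}" by auto
    moreover have "closed {z::real \<times> real. snd z \<le> fst z}" by (intro closed_Collect_le continuous_intros)
    ultimately show ?thesis by (simp add: compact_Int_closed compact_Times)
  qed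
  obtain a0 Ra where a0: "a0 \<in> borel_measurable borel" "0 \<le> Ra" "\<And>z. norm (a0 z) \<le> Ra" "AE z in lborel. z \<in> ?C \<longrightarrow> a0 z = a z"
    using compact_borel_representative[OF measurable(1) bounded(1) C] by blast
  obtain a1 Ra' where a1: "a1 \<in> borel_measurable borel" "0 \<le> Ra'" "\<And>z. norm (a1 z) \<le> Ra'" "AE z in lborel. z \<in> ?C \<longrightarrow> a1 z = a' z"
    using compact_borel_representative[OF measurable(2) bounded(2) C] by blast
  obtain b0 Rb where b0: "b0 \<in> borel_measurable borel" "0 \<le> Rb" "\<And>z. norm (b0 z) \<le> Rb" "AE z in lborel. z \<in> ?C \<longrightarrow> b0 z = b z"
    using compact_borel_representative[OF measurable(3) bounded(3) C] by blast
  obtain b1 Rb' where b1: "b1 \<in> borel_measurable borel" "0 \<le> Rb'" "\<And>z. norm (b1 z) \<le> Rb'" "AE z in lborel. z \<in> ?C \<longrightarrow> b1 z = b' z"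
    using compact_borel_representative[OF measurable(4) bounded(4) C] by blast
  obtain u0 Ru where u0: "u0 \<in> borel_measurable borel" "0 \<le> Ru" "\<And>z. norm (u0 z) \<le> Ru" "AE z in lborel. z \<in> ?C \<longrightarrow> u0 z = u z"
    using compact_borel_representative[OF u C] by blast
  have D\<Delta>: "?D \<subseteq> \<Delta>" by (auto simp: \<Delta>)
  obtain \<Phi>0 R\<Phi> where \<Phi>0: "\<Phi>0 \<in> borel_measurable borel" "0 \<le> R\<Phi>" "\<And>z. norm (\<Phi>0 z) \<le> R\<Phi>"
    "\<And>z. z \<notin> ?D \<Longrightarrow> \<Phi>0 z = 0" "AE z in lborel. z \<in> ?D \<longrightarrow> \<Phi>0 z = \<Phi> z"
    using bounded_borel_representative[OF \<Phi> D D\<Delta>] by blast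
  define R where "R = Ra + Ra' + Rb + Rb' + Ru + R\<Phi>"
  have R: "norm (a0 z) \<le> R" "norm (a1 z) \<le> R" "norm (b0 z) \<le> R" "norm (b1 z) \<le> R" "norm (u0 z) \<le> R" "norm (\<Phi>0 w) \<le> R"
    for z w
    using a0(2) a1(2) b0(2) b1(2) u0(2) \<Phi>0(2) a0(3)[of z] a1(3)[of z] b0(3)[of z] b1(3)[of z] u0(3)[of z] \<Phi>0(3)[of w]
    by (auto simp: R_def)
  define r where "r k = inverse (real (Suc k))" for k
  have r: "0 < r k" for k by (simp add: r_def)
  let ?avg = "\<lambda>g k z. ball_average (\<lambda>y. g (fst z, y)) (r k) (snd z)"
  have \<Phi>z: "\<Phi>0 (s, \<tau>) = 0" if "t0 + 1 < s" for s \<tau> using that by (intro \<Phi>0(4)) auto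
  obtain x y z \<kappa> where \<kappa>: "strict_mono (\<kappa> :: nat \<Rightarrow> nat)" and ym: "\<And>j. y j \<in> borel_measurable borel"
    and ylim: "\<And>t. t \<in> {t0..t0+1} \<Longrightarrow> (\<lambda>j. y j t) \<longlonglongrightarrow> x t"
    and zlim: "\<And>t. t \<in> {t0..t0+1} \<Longrightarrow> (\<lambda>j. z j t) \<longlonglongrightarrow> x t"
    and x0: "x t0 = x0" and lip: "\<And>s t. s \<in> {t0..t0+1} \<Longrightarrow> t \<in> {t0..t0+1} \<Longrightarrow>
        norm (x t - x s) \<le> ((R + R * R) + R * (R + R * R)) * \<bar>t - s\<bar>"
    and zeq: "\<And>j t. t \<in> {t0..t0+1} \<Longrightarrow> z j t = x0 + (LINT s:{t0..t}|lborel.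
       (?avg a0 (\<kappa> j) (s, y j s) + ?avg b0 (\<kappa> j) (s, y j s) *v ?avg u0 (\<kappa> j) (s, y j s)) +
       volterra \<Phi>0 t0 (\<lambda>\<tau>. ?avg a1 (\<kappa> j) (\<tau>, y j \<tau>) + ?avg b1 (\<kappa> j) (\<tau>, y j \<tau>) *v ?avg u0 (\<kappa> j) (\<tau>, y j \<tau>)) s)"
  proof (rule delayed_approximations_subconverge[of "?avg a0" "?avg a1" "?avg b0" "?avg b1" "?avg u0" R \<Phi>0 t0 x0])
    show "?avg a0 k \<in> borel_measurable borel" "?avg a1 k \<in> borel_measurable borel" "?avg b0 k \<in> borel_measurable borel"
      "?avg b1 k \<in> borel_measurable borel" "?avg u0 k \<in> borel_measurable borel" for k
      using a0(1) a1(1) b0(1) b1(1) u0(1) r by (auto intro: borel_measurable_ball_average)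
    show "norm (?avg a0 k z) \<le> R" "norm (?avg a1 k z) \<le> R" "norm (?avg b0 k z) \<le> R"
      "norm (?avg b1 k z) \<le> R" "norm (?avg u0 k z) \<le> R" for k z
      using a0(1) a1(1) b0(1) b1(1) u0(1) r R
      by (auto intro!: norm_ball_average_le borel_measurable_section)
  qed (use \<Phi>0(1) R(6) \<Phi>z in blast)+
  define L where "L = (R + R * R) + R * (R + R * R)"
  have R0: "0 \<le> R" using order_trans[OF norm_ge_zero R(1)] .
  then have L0: "0 \<le> L" by (simp add: L_def)
  \<comment> \<open>With speed at most \<open>L\<close> the trajectory stays within distance \<open>1/2\<close> of \<open>x0\<close> up to time \<open>t0 + \<alpha>\<close>.\<close>
  define \<alpha> where "\<alpha> = min 1 (1 / (2 * (L + 1)))"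
  have \<alpha>: "0 < \<alpha>" "\<alpha> \<le> 1" using L0 by (auto simp: \<alpha>_def)
  define J where "J = {t0..t0 + \<alpha>}"
  have J: "J \<subseteq> {t0..t0+1}" using \<alpha> by (auto simp: J_def)
  have near: "\<forall>t\<in>J. dist x0 (x t) \<le> 1/2"
  proof
    fix t assume that: "t \<in> J"
    have "norm (x t - x t0) \<le> L * \<bar>t - t0\<bar>"
      using lip[of t0 t] that J by (auto simp: L_def)
    also have "\<dots> \<le> (L + 1) * (1 / (2 * (L + 1)))"
      using that L0 by (intro mult_mono) (auto simp: J_def \<alpha>_def)
    also have "\<dots> = 1/2" using L0 by (simp add: field_simps)
    finally show "dist x0 (x t) \<le> 1/2" by (simp add: x0 dist_norm norm_minus_commute)
  qed
  define \<rho> where "\<rho> = (\<lambda>j. r (\<kappa> j))"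
  have \<rho>: "0 < \<rho> j" "\<rho> \<longlonglongrightarrow> 0" for j
  proof -
    show "0 < \<rho> j" using r by (simp add: \<rho>_def)
    show "\<rho> \<longlonglongrightarrow> 0"
      using LIMSEQ_subseq_LIMSEQ[OF LIMSEQ_inverse_real_of_nat \<kappa>] by (simp only: \<rho>_def r_def o_def)
  qed
  define A A' B B' v where
    A_def: "A j t = ball_average (\<lambda>y. a0 (t, y)) (\<rho> j) (y j t)" and
    A'_def: "A' j t = ball_average (\<lambda>y. a1 (t, y)) (\<rho> j) (y j t)" and
    B_def: "B j t = ball_average (\<lambda>y. b0 (t, y)) (\<rho> j) (y j t)" and
    B'_def: "B' j t = ball_average (\<lambda>y. b1 (t, y)) (\<rho> j) (y j t)" and
    v_def: "v j t = ball_average (\<lambda>y. u0 (t, y)) (\<rho> j) (y j t)" for j t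
  have meas: "A j \<in> borel_measurable borel" "A' j \<in> borel_measurable borel" "B j \<in> borel_measurable borel"
      "B' j \<in> borel_measurable borel" "v j \<in> borel_measurable borel" for j
    using borel_measurable_along_curve[OF borel_measurable_ball_average[OF a0(1) \<rho>(1)] ym]
      borel_measurable_along_curve[OF borel_measurable_ball_average[OF a1(1) \<rho>(1)] ym]
      borel_measurable_along_curve[OF borel_measurable_ball_average[OF b0(1) \<rho>(1)] ym]
      borel_measurable_along_curve[OF borel_measurable_ball_average[OF b1(1) \<rho>(1)] ym]
      borel_measurable_along_curve[OF borel_measurable_ball_average[OF u0(1) \<rho>(1)] ym]
    by (simp_all add: A_def[abs_def] A'_def[abs_def] B_def[abs_def] B'_def[abs_def] v_def[abs_def])
  have bnd: "norm (A j t) \<le> R" "norm (A' j t) \<le> R" "norm (B j t) \<le> R" "norm (B' j t) \<le> R" "norm (v j t) \<le> R" for j t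
    unfolding A_def A'_def B_def B'_def v_def
    using a0(1) a1(1) b0(1) b1(1) u0(1) \<rho>(1) R by (auto intro!: norm_ball_average_le borel_measurable_section)
  have yJ: "\<forall>t\<in>J. (\<lambda>j. y j t) \<longlonglongrightarrow> x t" using ylim J by blast
  note along = averages_along_curves_tendsto[OF _ _ _ _ J near \<rho> yJ]
  have limA: "AE t in lborel. t \<in> J \<longrightarrow> (\<lambda>j. A j t) \<longlonglongrightarrow> a (t, x t)"
    unfolding A_def by (rule along[OF a0(1) a0(3) a0(4) continuous(1)])
  have limA': "AE t in lborel. t \<in> J \<longrightarrow> (\<lambda>j. A' j t) \<longlonglongrightarrow> a' (t, x t)"
    unfolding A'_def by (rule along[OF a1(1) a1(3) a1(4) continuous(2)])
  have limB: "AE t in lborel. t \<in> J \<longrightarrow> (\<lambda>j. B j t) \<longlonglongrightarrow> b (t, x t)"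
    unfolding B_def by (rule along[OF b0(1) b0(3) b0(4) continuous(3)])
  have limB': "AE t in lborel. t \<in> J \<longrightarrow> (\<lambda>j. B' j t) \<longlonglongrightarrow> b' (t, x t)"
    unfolding B'_def by (rule along[OF b1(1) b1(3) b1(4) continuous(4)])
  \<comment> \<open>One family of weights serves for the controls and for both right-hand sides.\<close>
  obtain c where c: "\<And>k. tail_weights k (c k)"
    and cae: "AE t in lebesgue_on {t0..t0+1}. convergent (\<lambda>k. weighted_sum (c k) (\<lambda>j. v j t))"
  proof (rule convex_tails_AE_convergent[of "lebesgue_on {t0..t0+1}" v R])
    show "finite_measure (lebesgue_on {t0..t0+1})" by (rule finite_measure_lebesgue_on) simp
    show "v j \<in> borel_measurable (lebesgue_on {t0..t0+1})" for j
      using meas(5)[of j] by (intro measurable_restrict_space1 measurable_completion) simp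
  qed (use bnd(5) in blast)+
  define ueq where "ueq t = lim (\<lambda>k. weighted_sum (c k) (\<lambda>j. v j t))" for t
  have ueqm: "ueq \<in> borel_measurable borel"
    unfolding ueq_def[abs_def] by (intro borel_measurable_lim_metric borel_measurable_weighted_sum[OF meas(5)])
  have ueql: "AE t in lborel. t \<in> J \<longrightarrow> (\<lambda>k. weighted_sum (c k) (\<lambda>j. v j t)) \<longlonglongrightarrow> ueq t"
    using cae[unfolded AE_lebesgue_on_iff[OF atLeastAtMost_borel]]
    by eventually_elim (use J in \<open>auto simp: ueq_def convergent_LIMSEQ_iff\<close>)
  have ueqK: "AE t in lborel. t \<in> J \<longrightarrow> ueq t \<in> filippov_reg u t (x t)"
    using AE_representative_near_curve[OF u0(4) J near] ueql
  proof eventually_elim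
    case (elim t)
    show ?case
    proof
      assume t: "t \<in> J"
      show "ueq t \<in> filippov_reg u t (x t)"
      proof (rule limit_of_averages_in_filippov_reg[OF borel_measurable_section[OF u0(1)] u0(3) _ _ \<rho> ylim c])
        show "AE y in lborel. y \<in> ball (x t) (1/2) \<longrightarrow> u0 (t, y) = u (t, y)" using elim t by blast
        show "t \<in> {t0..t0+1}" using t J by blast
        show "(\<lambda>k. weighted_sum (c k) (\<lambda>j. ball_average (\<lambda>y. u0 (t, y)) (\<rho> j) (y j t))) \<longlonglongrightarrow> ueq t"
          using elim t by (simp add: v_def)
      qed simp
    qed
  qed
  define p h where p_def: "p j s = A j s + B j s *v v j s" and h_def: "h j s = A' j s + B' j s *v v j s" for j s
  \<comment> \<open>Borel versions of the limits; \<open>f s (x s) (ueq s)\<close> itself is only Lebesgue measurable.\<close>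
  define P where "P s = lim (\<lambda>k. weighted_sum (c k) (\<lambda>j. p j s))" for s
  define H where "H s = lim (\<lambda>k. weighted_sum (c k) (\<lambda>j. h j s))" for s
  have pm: "p j \<in> borel_measurable borel" and hm: "h j \<in> borel_measurable borel" for j
    using meas[of j] by (auto simp: p_def[abs_def] h_def[abs_def] intro!: borel_measurable_add borel_measurable_matrix_vector_mult)
  have Pm: "P \<in> borel_measurable borel" and Hm: "H \<in> borel_measurable borel"
    by (auto simp: P_def[abs_def] H_def[abs_def] intro!: borel_measurable_lim_metric
        borel_measurable_weighted_sum[OF pm] borel_measurable_weighted_sum[OF hm])
  have prod: "norm (M *v w) \<le> R * R" if "norm M \<le> R" "norm w \<le> R" for M :: "real^'m^'n" and w
    using norm_matrix_vector_mult_le[of M w] mult_mono[OF that] R0 by simp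
  have pb: "norm (p j s) \<le> R + R * R" and hb: "norm (h j s) \<le> R + R * R" for j s
    by (auto simp: p_def h_def intro!: norm_triangle_mono prod bnd)
  have plim: "AE s in lborel. s \<in> J \<longrightarrow> (\<lambda>k. weighted_sum (c k) (\<lambda>j. p j s)) \<longlonglongrightarrow> f s (x s) (ueq s)"
    using limA limB ueql
    by eventually_elim (auto simp: p_def f intro!: weighted_sum_affine_tendsto[OF c _ _ bnd(5)])
  have hlim: "AE s in lborel. s \<in> J \<longrightarrow> (\<lambda>k. weighted_sum (c k) (\<lambda>j. h j s)) \<longlonglongrightarrow> f' s (x s) (ueq s)"
    using limA' limB' ueql
    by eventually_elim (auto simp: h_def f' intro!: weighted_sum_affine_tendsto[OF c _ _ bnd(5)])
  have Pf: "AE s in lborel. s \<in> J \<longrightarrow> P s = f s (x s) (ueq s)"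
    using plim by eventually_elim (auto simp: P_def limI)
  have Hf: "AE s in lborel. s \<in> J \<longrightarrow> H s = f' s (x s) (ueq s)"
    using hlim by eventually_elim (auto simp: H_def limI)
  have Pl: "AE s in lborel. s \<in> {t0..t0+\<alpha>} \<longrightarrow> (\<lambda>k. weighted_sum (c k) (\<lambda>j. p j s)) \<longlonglongrightarrow> P s"
    using plim by eventually_elim (auto simp: P_def limI J_def)
  have Hl: "AE s in lborel. s \<in> {t0..t0+\<alpha>} \<longrightarrow> (\<lambda>k. weighted_sum (c k) (\<lambda>j. h j s)) \<longlonglongrightarrow> H s"
    using hlim by eventually_elim (auto simp: H_def limI J_def)
  define q where "q s = P s + volterra \<Phi>0 t0 H s" for s
  have zeq': "z j t = x0 + (LINT s:{t0..t}|lborel. p j s + volterra \<Phi>0 t0 (h j) s)" if "t \<in> {t0..t0+\<alpha>}" for j t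
    using zeq[of t j] that \<alpha>(2) by (simp add: p_def h_def[abs_def] A_def A'_def B_def B'_def v_def \<rho>_def)
  have zlim': "(\<lambda>j. z j t) \<longlonglongrightarrow> x t" if "t \<in> {t0..t0+\<alpha>}" for t
    using zlim[of t] that \<alpha>(2) by simp
  note limit = volterra_equation_limit[OF \<Phi>0(1) R(6) \<Phi>z pm pb hm hb zeq' zlim' c Pm Pl Hm Hl, folded q_def]
  have \<Phi>H: "set_integrable lborel {t0..t} (\<lambda>\<tau>. \<Phi>0 (t, \<tau>) *v H \<tau>)" if "t \<in> J" for t
    by (rule limit(1)) (use that in \<open>auto simp: J_def\<close>)
  have qint: "set_integrable lborel {t0..t} q" if "t \<in> J" for t
    by (rule limit(2)) (use that in \<open>auto simp: J_def\<close>)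
  have xq: "x t = x0 + (LINT s:{t0..t}|lborel. q s)" if "t \<in> J" for t
    by (rule limit(3)) (use that in \<open>auto simp: J_def\<close>)
  have xint: "x t = x0 + integral {t0..t} q" if "t \<in> J" for t
    using xq[OF that] set_borel_integral_eq_integral(2)[OF qint[OF that]] by simp
  have "q integrable_on {t0..t0+\<alpha>}"
    by (rule set_borel_integral_eq_integral(1)[OF qint]) (use \<alpha> in \<open>simp add: J_def\<close>)
  note diff = indefinite_integral_has_vector_derivative_ae[OF this]
  let ?I = "{t0..<t0 + \<alpha>}"
  have main: "AE t in lborel. t \<in> ?I \<longrightarrow> ueq t \<in> filippov_reg u t (x t) \<and>
      (\<exists>w. has_bochner_integral (lebesgue_on {t0..t}) (\<lambda>\<tau>. \<Phi> (t, \<tau>) *v f' \<tau> (x \<tau>) (ueq \<tau>)) w \<and>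
           (x has_vector_derivative f t (x t) (ueq t) + w) (at t within ?I))"
    using AE_lborel_singleton[of t0] ueqK diff Pf AE_lborel_slices[OF \<Phi>0(5)]
  proof eventually_elim
    case (elim t)
    show ?case
    proof (intro impI conjI exI)
      assume t: "t \<in> ?I"
      then have tJ: "t \<in> J" and t': "t \<in> {t0<..<t0+\<alpha>}" using elim(1) by (auto simp: J_def)
      show "ueq t \<in> filippov_reg u t (x t)" using elim(2) tJ by blast
      show "has_bochner_integral (lebesgue_on {t0..t}) (\<lambda>\<tau>. \<Phi> (t, \<tau>) *v f' \<tau> (x \<tau>) (ueq \<tau>)) (volterra \<Phi>0 t0 H t)"
        unfolding volterra_def
      proof (rule has_bochner_integral_lebesgue_on_AE_eq[OF _ \<Phi>H[OF tJ]])
        show "AE \<tau> in lborel. \<tau> \<in> {t0..t} \<longrightarrow> \<Phi>0 (t, \<tau>) *v H \<tau> = \<Phi> (t, \<tau>) *v f' \<tau> (x \<tau>) (ueq \<tau>)"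
          using elim(5) Hf
        proof eventually_elim
          case (elim \<tau>)
          then show ?case using t \<alpha>(2) by (auto simp: J_def)
        qed
      qed simp
      have "((\<lambda>s. x0 + integral {t0..s} q) has_vector_derivative q t) (at t)"
        using elim(3) t' has_vector_derivative_add[OF has_vector_derivative_const, of "\<lambda>s. integral {t0..s} q" "q t" "at t" x0]
        by simp
      then have "(x has_vector_derivative q t) (at t)"
        by (rule has_vector_derivative_transform_within_open[where S="{t0<..<t0+\<alpha>}"])
          (use t' xint in \<open>auto simp: J_def\<close>)
      moreover have "q t = f t (x t) (ueq t) + volterra \<Phi>0 t0 H t" using elim(4) tJ by (simp add: q_def)
      ultimately show "(x has_vector_derivative f t (x t) (ueq t) + volterra \<Phi>0 t0 H t) (at t within ?I)"
        by (simp add: has_vector_derivative_at_within)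
    qed
  qed
  have ac: "ac_trajectory t0 x0 ?I x"
    unfolding ac_trajectory_def
  proof (intro conjI allI impI)
    show "forward_interval t0 ?I" using \<alpha>(1) by (auto simp: forward_interval_def)
    show "x t0 = x0" by (rule x0)
    fix s1 s2 assume "{s1..s2} \<subseteq> ?I"
    then have "{s1..s2} \<subseteq> {t0..t0+1}" using \<alpha>(2) by force
    then show "absolutely_continuous_on {s1..s2} x"
      using L0 lip by (intro lipschitz_imp_absolutely_continuous_on[where L=L]) (auto simp: L_def subset_iff)
  qed
  have "ueq \<in> borel_measurable (lebesgue_on ?I)"
    using ueqm by (intro measurable_restrict_space1 measurable_completion) simp
  moreover have "?I \<in> sets borel" by simp
  ultimately have "utkin_solution_first u \<Phi> f f' t0 x0 ?I x"
    using ac main unfolding utkin_solution_first_def utkin_solution_def by (auto simp: AE_lebesgue_on_iff)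
  then show ?thesis using \<alpha>(1) by blast
qed

theorem theorem19:
  fixes \<Phi> :: "real \<times> real \<Rightarrow> real^'n^'n"
    and \<Delta> :: "(real \<times> real) set"
    and a a' :: "real \<times> (real^'n) \<Rightarrow> real^'n"
    and b b' :: "real \<times> (real^'n) \<Rightarrow> real^'m^'n"
    and f f' :: "real \<Rightarrow> real^'n \<Rightarrow> real^'m \<Rightarrow> real^'n"
    and u :: "real \<times> (real^'n) \<Rightarrow> real^'m"
  assumes \<Delta>: "\<Delta> = {(t, \<tau>). t \<ge> \<tau>}"
    and \<Phi>: "\<Phi> \<in> borel_measurable (lebesgue_on \<Delta>)" "locally_essentially_bounded_on \<Delta> \<Phi>"
    and f: "\<And>t x v. f t x v = a (t, x) + b (t, x) *v v"
    and f': "\<And>t x v. f' t x v = a' (t, x) + b' (t, x) *v v"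
    and measurable: "a \<in> borel_measurable lebesgue" "a' \<in> borel_measurable lebesgue"
      "b \<in> borel_measurable lebesgue" "b' \<in> borel_measurable lebesgue"
    and bounded: "locally_essentially_bounded_on UNIV a" "locally_essentially_bounded_on UNIV a'"
      "locally_essentially_bounded_on UNIV b" "locally_essentially_bounded_on UNIV b'"
    and continuous: "\<And>t. continuous_on UNIV (\<lambda>x. a (t, x))"
      "\<And>t. continuous_on UNIV (\<lambda>x. a' (t, x))"
      "\<And>t. continuous_on UNIV (\<lambda>x. b (t, x))"
      "\<And>t. continuous_on UNIV (\<lambda>x. b' (t, x))"
    and u: "u \<in> borel_measurable lebesgue" "locally_essentially_bounded_on UNIV u"
  shows "\<forall>t0 x0.
    (\<exists>\<alpha>>0. \<exists>x. utkin_solution_first u \<Phi> f f' t0 x0 {t0..<t0 + \<alpha>} x \<and>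
               utkin_solution_second u \<Phi> f f' t0 x0 {t0..<t0 + \<alpha>} x) \<and>
    (\<forall>I x. utkin_solution_first u \<Phi> f f' t0 x0 I x \<longrightarrow> filippov_solution u \<Phi> f f' t0 x0 I x)"
proof (intro allI conjI impI)
  fix t0 x0
  obtain \<alpha> x where \<alpha>: "0 < \<alpha>" and x: "utkin_solution_first u \<Phi> f f' t0 x0 {t0..<t0 + \<alpha>} x"
    using utkin_first_exists[OF assms] by blast
  then show "\<exists>\<alpha>>0. \<exists>x. utkin_solution_first u \<Phi> f f' t0 x0 {t0..<t0 + \<alpha>} x \<and>
               utkin_solution_second u \<Phi> f f' t0 x0 {t0..<t0 + \<alpha>} x"
    using utkin_first_imp_second[OF x] by blast
  show "filippov_solution u \<Phi> f f' t0 x0 I x" if "utkin_solution_first u \<Phi> f f' t0 x0 I x" for I x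
    by (rule utkin_first_imp_filippov[OF f f' continuous u(2) that])
qed

end
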